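(* Let $K$ be a field. (a) Let $P$ be a discrete polymatroid with set of bases $B$. If $K[P]$ has quadratic relations, then so has $K[B]$; if $K[P]$ has a quadratic Gröbner basis, then so has $K[B]$; if $K[P]$ is Koszul, then so is $K[B]$. (b) Let $\mathcal{E}$ be a property of standard graded $K$-algebras (invariant under graded isomorphism). If $K[B(P)]$ satisfies $\mathcal{E}$ for all discrete polymatroids $P$ (on all ground sets $[n]$), then $K[P]$ satisfies $\mathcal{E}$ for all discrete polymatroids $P$.
   Context: $[n]=\{1,\dots,n\}$; $\mathbb{Z}_+^n$ is the set of integer vectors with nonnegative entries. $|u|=\sum_iu(i)$. $u\le v$ is the componentwise order; $u<v$ means $u\le v$, $u\neq v$; $u\vee v$ is the componentwise maximum. A discrete polymatroid on $[n]$ is a nonempty finite set $P\subset\mathbb{Z}_+^n$ such that (D1) if $u\in P$, $v\in\mathbb{Z}_+^n$ and $v\le u$, then $v\in P$; (D2) if $u,v\in P$ with $|v|>|u|$, then there is $w\in P$ with $u<w\le u\vee v$. A base of $P$ is a vector $u\in P$ with $u<v$ for no $v\in P$; $B(P)$ is the set of bases. With $t^u=t_1^{u(1)}\cdots t_n^{u(n)}$, put $K[P]=K[t^us: u\in P]$ and $K[B]=K[t^us:u\in B]$, subalgebras of $K[t_1,\dots,t_n,s]$, graded by the exponent of $s$ (so standard graded). The defining ideal of $K[P]$ (resp. $K[B]$) is the kernel of the map from the polynomial ring $K[x_u: u\in P]$ (resp. $K[x_u:u\in B]$) sending $x_u\mapsto t^us$. "Has quadratic relations" means that the defining ideal is generated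 by quadratic polynomials; "has a quadratic Gröbner basis" means that the defining ideal has, for some term order, a Gröbner basis consisting of quadratic polynomials. Koszul means that the residue field $K$ has a linear resolution over the algebra. *)

theory Defs
  imports
    "HOL-Library.Poly_Mapping"
    "HOL-Library.FuncSet"
    "HOL-Algebra.Algebraic_Closure_Type"
    "HOL-Algebra.Generated_Rings"
    "HOL-Algebra.Ideal"
    "HOL-Algebra.QuotRing"
begin

section \<open>Discrete polymatroids\<close>

text \<open>Vectors indexed by \<open>{1..n}\<close> are functions on \<open>nat\<close> that vanish outside \<open>{1..n}\<close>; on these
  the pointwise order and supremum of the function type are the componentwise ones.\<close>

definition nn_vectors :: "nat \<Rightarrow> (nat \<Rightarrow> nat) set" where
  "nn_vectors n = {u. \<forall>i. i \<notin> {1..n} \<longrightarrow> u i = 0}"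

definition modulus :: "nat \<Rightarrow> (nat \<Rightarrow> nat) \<Rightarrow> nat" where
  "modulus n u = (\<Sum>i=1..n. u i)"

definition discrete_polymatroid :: "nat \<Rightarrow> (nat \<Rightarrow> nat) set \<Rightarrow> bool" where
  "discrete_polymatroid n P \<longleftrightarrow>
     P \<noteq> {} \<and> finite P \<and> P \<subseteq> nn_vectors n \<and>
     (\<forall>u\<in>P. \<forall>v\<in>nn_vectors n. v \<le> u \<longrightarrow> v \<in> P) \<and>
     (\<forall>u\<in>P. \<forall>v\<in>P. modulus n v > modulus n u \<longrightarrow> (\<exists>w\<in>P. u < w \<and> w \<le> sup u v))"

definition bases :: "(nat \<Rightarrow> nat) set \<Rightarrow> (nat \<Rightarrow> nat) set" where
  "bases P = {u \<in> P. \<not> (\<exists>v\<in>P. u < v)}"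


section \<open>Polynomial rings\<close>

type_synonym 'x monomial = "'x \<Rightarrow>\<^sub>0 nat"
type_synonym ('x, 'k) mpoly = "'x monomial \<Rightarrow>\<^sub>0 'k"

definition const_poly :: "'k \<Rightarrow> ('x, 'k::field) mpoly" where
  "const_poly c = Poly_Mapping.single 0 c"

definition mono_poly :: "'x monomial \<Rightarrow> ('x, 'k::field) mpoly" where
  "mono_poly m = Poly_Mapping.single m 1"

definition var_poly :: "'x \<Rightarrow> ('x, 'k::field) mpoly" where
  "var_poly x = mono_poly (Poly_Mapping.single x 1)"

definition total_degree :: "'x monomial \<Rightarrow> nat" where
  "total_degree m = (\<Sum>x\<in>Poly_Mapping.keys m. Poly_Mapping.lookup m x)"

definition monomials :: "'x set \<Rightarrow> 'x monomial set" where
  "monomials S = {m. Poly_Mapping.keys m \<subseteq> S}"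

definition polys :: "'x set \<Rightarrow> ('x, 'k::field) mpoly set" where
  "polys S = {p. Poly_Mapping.keys p \<subseteq> monomials S}"

definition poly_ring :: "'x set \<Rightarrow> ('x, 'k::field) mpoly ring" where
  "poly_ring S = ring_of_type_algebra\<lparr>carrier := polys S\<rparr>"

definition poly_subst :: "('x \<Rightarrow> ('y, 'k) mpoly) \<Rightarrow> ('x, 'k::field) mpoly \<Rightarrow> ('y, 'k) mpoly" where
  "poly_subst f p = (\<Sum>m\<in>Poly_Mapping.keys p. const_poly (Poly_Mapping.lookup p m) *
     (\<Prod>x\<in>Poly_Mapping.keys m. f x ^ Poly_Mapping.lookup m x))"

text \<open>The ideal is homogeneous in all applications and contains no nonzero polynomial of degree
  less than 2, so it makes no difference that quadratic polynomials are required to be homogeneous.\<close>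

definition quadratic :: "('x, 'k::field) mpoly \<Rightarrow> bool" where
  "quadratic p \<longleftrightarrow> p \<noteq> 0 \<and> (\<forall>m\<in>Poly_Mapping.keys p. total_degree m = 2)"

definition quadratically_generated :: "'x set \<Rightarrow> ('x, 'k::field) mpoly set \<Rightarrow> bool" where
  "quadratically_generated S I \<longleftrightarrow>
     (\<exists>G \<subseteq> polys S. (\<forall>g\<in>G. quadratic g) \<and> I = genideal (poly_ring S) G)"

text \<open>Term orders are explicit relations because the linear order instance on
  \<^typ>\<open>'x \<Rightarrow>\<^sub>0 nat\<close> in the library is just one such order. Well-foundedness is automatic for
  finite \<open>S\<close>, the only case used here.\<close>

definition term_order :: "'x set \<Rightarrow> ('x monomial \<times> 'x monomial) set \<Rightarrow> bool" where
  "term_order S ord \<longleftrightarrow>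
     linear_order_on (monomials S) ord \<and>
     (\<forall>m\<in>monomials S. (0, m) \<in> ord) \<and>
     (\<forall>a b. \<forall>c\<in>monomials S. (a, b) \<in> ord \<longrightarrow> (a + c, b + c) \<in> ord)"

definition lead_mono :: "('x monomial \<times> 'x monomial) set \<Rightarrow> ('x, 'k::field) mpoly \<Rightarrow> 'x monomial"
  where
  "lead_mono ord p =
     (THE m. m \<in> Poly_Mapping.keys p \<and> (\<forall>m'\<in>Poly_Mapping.keys p. (m', m) \<in> ord))"

definition lead_ideal ::
  "'x set \<Rightarrow> ('x monomial \<times> 'x monomial) set \<Rightarrow> ('x, 'k::field) mpoly set \<Rightarrow> ('x, 'k) mpoly set" where
  "lead_ideal S ord F = genideal (poly_ring S) {mono_poly (lead_mono ord f) |f. f \<in> F \<and> f \<noteq> 0}"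

definition groebner_basis ::
  "'x set \<Rightarrow> ('x monomial \<times> 'x monomial) set \<Rightarrow> ('x, 'k::field) mpoly set \<Rightarrow> ('x, 'k) mpoly set \<Rightarrow> bool"
  where
  "groebner_basis S ord I G \<longleftrightarrow>
     finite G \<and> G \<subseteq> I \<and> lead_ideal S ord G = lead_ideal S ord I"

definition has_quadratic_groebner_basis :: "'x set \<Rightarrow> ('x, 'k::field) mpoly set \<Rightarrow> bool" where
  "has_quadratic_groebner_basis S I \<longleftrightarrow>
     (\<exists>ord G. term_order S ord \<and> groebner_basis S ord I G \<and> (\<forall>g\<in>G. quadratic g))"


section \<open>Standard graded algebras\<close>

record ('k, 'a) graded_algebra = "('k, 'a) module" +
  homog :: "nat \<Rightarrow> 'a set"

definition standard_graded :: "('k::field, 'a) graded_algebra \<Rightarrow> bool" where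
  "standard_graded A \<longleftrightarrow>
     algebra (ring_of_type_algebra :: 'k ring) A \<and>
     (\<forall>i. submodule (homog A i) (ring_of_type_algebra :: 'k ring) A) \<and>
     (\<forall>a\<in>carrier A. \<exists>!f. (\<forall>i. f i \<in> homog A i) \<and> finite {i. f i \<noteq> \<zero>\<^bsub>A\<^esub>} \<and>
        a = finsum A f {i. f i \<noteq> \<zero>\<^bsub>A\<^esub>}) \<and>
     (\<forall>i j. \<forall>a\<in>homog A i. \<forall>b\<in>homog A j. a \<otimes>\<^bsub>A\<^esub> b \<in> homog A (i + j)) \<and>
     \<one>\<^bsub>A\<^esub> \<noteq> \<zero>\<^bsub>A\<^esub> \<and> homog A 0 = {c \<odot>\<^bsub>A\<^esub> \<one>\<^bsub>A\<^esub> |c. True} \<and>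
     (\<exists>S. finite S \<and> S \<subseteq> homog A 1 \<and> carrier A = generate_ring A (homog A 0 \<union> S))"

definition graded_iso ::
  "('k, 'a) graded_algebra \<Rightarrow> ('k, 'b) graded_algebra \<Rightarrow> ('a \<Rightarrow> 'b) set" where
  "graded_iso A B = {h \<in> ring_iso A B.
     (\<forall>c. \<forall>a\<in>carrier A. h (c \<odot>\<^bsub>A\<^esub> a) = c \<odot>\<^bsub>B\<^esub> h a) \<and>
     (\<forall>i. h ` homog A i = homog B i)}"

definition irrelevant_ideal :: "('k, 'a) graded_algebra \<Rightarrow> 'a set" where
  "irrelevant_ideal A = genideal A (\<Union>i\<in>{1..}. homog A i)"

definition homog_int :: "('k, 'a) graded_algebra \<Rightarrow> int \<Rightarrow> 'a set" where
  "homog_int A e = (if e < 0 then {\<zero>\<^bsub>A\<^esub>} else homog A (nat e))"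

definition free_module :: "('k, 'a) graded_algebra \<Rightarrow> nat \<Rightarrow> (nat \<Rightarrow> 'a) set" where
  "free_module A r = {..<r} \<rightarrow>\<^sub>E carrier A"

definition mat_apply ::
  "('k, 'a) graded_algebra \<Rightarrow> nat \<Rightarrow> nat \<Rightarrow> (nat \<Rightarrow> nat \<Rightarrow> 'a) \<Rightarrow> (nat \<Rightarrow> 'a) \<Rightarrow> (nat \<Rightarrow> 'a)" where
  "mat_apply A r s M v = (\<lambda>j\<in>{..<r}. finsum A (\<lambda>k. M j k \<otimes>\<^bsub>A\<^esub> v k) {..<s})"

text \<open>A graded free resolution \<open>\<dots> \<rightarrow> F\<^sub>1 \<rightarrow> F\<^sub>0 = A \<rightarrow> K \<rightarrow> 0\<close> of the residue field
  \<open>K = A/A\<^sub>+\<close> with \<open>F\<^sub>i\<close> the direct sum of the shifted modules \<open>A(-d i j)\<close> for \<open>j < b i\<close>.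
  The matrix \<open>D i\<close> represents the differential from \<open>F\<^sub>i\<^sub>+\<^sub>1\<close> to \<open>F\<^sub>i\<close>, and the condition on its
  entries says that this differential preserves degrees.\<close>

definition residue_field_resolution ::
  "('k, 'a) graded_algebra \<Rightarrow> (nat \<Rightarrow> nat) \<Rightarrow> (nat \<Rightarrow> nat \<Rightarrow> int) \<Rightarrow> (nat \<Rightarrow> nat \<Rightarrow> nat \<Rightarrow> 'a) \<Rightarrow> bool"
  where
  "residue_field_resolution A b d D \<longleftrightarrow>
     b 0 = 1 \<and> d 0 0 = 0 \<and>
     (\<forall>i. \<forall>j<b i. \<forall>k<b (i + 1). D i j k \<in> homog_int A (d (i + 1) k - d i j)) \<and>
     mat_apply A (b 0) (b 1) (D 0) ` free_module A (b 1) =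
       {v \<in> free_module A (b 0). v 0 \<in> irrelevant_ideal A} \<and>
     (\<forall>i. mat_apply A (b (i + 1)) (b (i + 2)) (D (i + 1)) ` free_module A (b (i + 2)) =
       {v \<in> free_module A (b (i + 1)).
          mat_apply A (b i) (b (i + 1)) (D i) v = (\<lambda>j\<in>{..<b i}. \<zero>\<^bsub>A\<^esub>)})"

definition koszul :: "('k, 'a) graded_algebra \<Rightarrow> bool" where
  "koszul A \<longleftrightarrow>
     (\<exists>b d D. residue_field_resolution A b d D \<and> (\<forall>i. \<forall>j<b i. d i j = int i))"


section \<open>Toric algebras\<close>

text \<open>In \<open>K[t\<^sub>1, \<dots>, t\<^sub>n, s]\<close> the variable \<open>t\<^sub>i\<close> has index \<open>i\<close> and \<open>s\<close> has index 0.\<close>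

definition toric_gen :: "nat \<Rightarrow> (nat \<Rightarrow> nat) \<Rightarrow> (nat, 'k::field) mpoly" where
  "toric_gen n u = (\<Prod>i=1..n. var_poly i ^ u i) * var_poly 0"

definition toric_algebra ::
  "nat \<Rightarrow> (nat \<Rightarrow> nat) set \<Rightarrow> ('k::field, (nat, 'k) mpoly) graded_algebra" where
  "toric_algebra n S =
     \<lparr>carrier = poly_subst (toric_gen n) ` polys S,
      monoid.mult = (*), one = 1, ring.zero = 0, add = (+),
      module.smult = (\<lambda>c f. const_poly c * f),
      homog = (\<lambda>i. {f \<in> poly_subst (toric_gen n) ` polys S.
        \<forall>m\<in>Poly_Mapping.keys f. Poly_Mapping.lookup m 0 = i})\<rparr>"

definition defining_ideal :: "nat \<Rightarrow> (nat \<Rightarrow> nat) set \<Rightarrow> ((nat \<Rightarrow> nat), 'k::field) mpoly set" where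
  "defining_ideal n S = {p \<in> polys S. poly_subst (toric_gen n) p = 0}"

end

theory Submission
  imports Defs
begin

text \<open>
Let \<open>d\<close> be the largest modulus of a vector in \<open>P\<close>. By the exchange property the bases are the vectors
of modulus \<open>d\<close> (\<open>bases_eq_maximal_modulus\<close>). Hence the monomials of \<open>K[B]\<close> are those monomials of
\<open>K[P]\<close> on which the nonnegative weight "\<open>d\<close> times the degree in \<open>s\<close> minus the degree in the \<open>t\<^sub>i\<close>"
vanishes. They form a face of the monoid of all monomials of \<open>K[P]\<close>, so that deleting all other
monomials is a graded algebra retraction from \<open>K[P]\<close> onto \<open>K[B]\<close>, which comes from setting \<open>x\<^sub>u = 0\<close>
for \<open>u\<close> outside \<open>B\<close>.

This retraction proves part (a). The defining ideal of \<open>K[B]\<close> is the image of the defining ideal of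
\<open>K[P]\<close>, so quadratic generators project to quadratic generators. The same holds for Groebner bases,
since a leading monomial in the variables \<open>x\<^sub>u\<close> with \<open>u\<close> in \<open>B\<close> survives the projection. The Koszul property
passes to any graded retract (\<open>koszul_retract\<close>): the retraction lifts to a chain map from a linear
resolution to itself, which is given by idempotent matrices over \<open>K\<close>, and the image of this chain map is a
linear resolution over the retract.

For part (b), \<open>P\<close> is homogenized: the vectors \<open>(u, a)\<close> with \<open>u\<close> in \<open>P\<close> and \<open>a \<le> d - |u|\<close> form a discrete
polymatroid, whose bases are the vectors \<open>(u, d - |u|)\<close>. Its base algebra is isomorphic to \<open>K[P]\<close>,
since the additional exponent is determined by the others (\<open>graded_iso_homogenization\<close>).
\<close>

abbreviation lookup where "lookup \<equiv> Poly_Mapping.lookup"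
abbreviation keys where "keys \<equiv> Poly_Mapping.keys"
abbreviation single where "single \<equiv> Poly_Mapping.single"

section \<open>Restricting and pushing forward finitely supported functions\<close>

lemma poly_mapping_eq_sum_single:
  assumes "finite A" "keys p \<subseteq> A"
  shows "p = (\<Sum>m\<in>A. single m (lookup p m))"
proof (rule poly_mapping_eqI)
  fix k
  have "lookup (\<Sum>m\<in>A. single m (lookup p m)) k = (\<Sum>m\<in>A. if m = k then lookup p m else 0)"
    unfolding lookup_sum by (intro sum.cong) (auto simp: lookup_single when_def)
  also have "\<dots> = lookup p k"
    using assms by (auto simp: sum.delta in_keys_iff)
  finally show "lookup p k = lookup (\<Sum>m\<in>A. single m (lookup p m)) k" by simp
qed

lemma times_eq_sum_single:
  fixes p q :: "'a::comm_monoid_add \<Rightarrow>\<^sub>0 'k::comm_ring_1"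
  shows "p * q = (\<Sum>a\<in>keys p. \<Sum>b\<in>keys q. single (a + b) (lookup p a * lookup q b))"
proof -
  have "p * q = (\<Sum>a\<in>keys p. single a (lookup p a)) * (\<Sum>b\<in>keys q. single b (lookup q b))"
    by (simp add: poly_mapping_eq_sum_single[symmetric])
  then show ?thesis by (simp add: sum_product mult_single)
qed

lift_definition restrict_keys :: "'a set \<Rightarrow> ('a \<Rightarrow>\<^sub>0 'b::zero) \<Rightarrow> 'a \<Rightarrow>\<^sub>0 'b"
  is "\<lambda>W f k. if k \<in> W then f k else 0"
  by (erule finite_subset[rotated]) auto

lemma lookup_restrict_keys: "lookup (restrict_keys W p) k = (if k \<in> W then lookup p k else 0)"
  by transfer simp

lemma keys_restrict_keys: "keys (restrict_keys W p) = keys p \<inter> W"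
  by (auto simp: in_keys_iff lookup_restrict_keys split: if_splits)

lemma restrict_keys_id: "keys p \<subseteq> W \<Longrightarrow> restrict_keys W p = p"
  by (rule poly_mapping_eqI) (auto simp: lookup_restrict_keys in_keys_iff)

lemma restrict_keys_cong:
  "(\<And>k. k \<in> keys p \<Longrightarrow> k \<in> V \<longleftrightarrow> k \<in> W) \<Longrightarrow> restrict_keys V p = restrict_keys W p"
  by (rule poly_mapping_eqI) (auto simp: lookup_restrict_keys in_keys_iff)

lemma restrict_keys_0 [simp]: "restrict_keys W 0 = 0"
  by (rule poly_mapping_eqI) (simp add: lookup_restrict_keys)

lemma restrict_keys_empty [simp]: "restrict_keys {} p = 0"
  by (rule poly_mapping_eqI) (simp add: lookup_restrict_keys)

lemma restrict_keys_add: "restrict_keys W (p + q) = restrict_keys W p + restrict_keys W q"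
  for p q :: "'a \<Rightarrow>\<^sub>0 'b::monoid_add"
  by (rule poly_mapping_eqI) (simp add: lookup_restrict_keys lookup_add)

lemma restrict_keys_sum: "restrict_keys W (sum f A) = (\<Sum>a\<in>A. restrict_keys W (f a))"
  for f :: "'c \<Rightarrow> 'a \<Rightarrow>\<^sub>0 'b::comm_monoid_add"
  by (rule poly_mapping_eqI) (simp add: lookup_restrict_keys lookup_sum)

lemma restrict_keys_single: "restrict_keys W (single m c) = (if m \<in> W then single m c else 0)"
  by (rule poly_mapping_eqI) (auto simp: lookup_restrict_keys lookup_single when_def)

text \<open>If the keys in \<open>W\<close> arise exactly as sums of keys in \<open>U\<close> and keys in \<open>V\<close>, then a product has no
other terms over \<open>W\<close>. With \<open>U = V = W\<close> this makes the restriction to a face of a monoid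
multiplicative, and with \<open>U\<close> everything it extracts a homogeneous component of a product with a
homogeneous factor.\<close>

lemma restrict_keys_times_gen:
  fixes p q :: "'a::comm_monoid_add \<Rightarrow>\<^sub>0 'k::comm_ring_1"
  assumes "\<And>a b. a \<in> keys p \<Longrightarrow> b \<in> keys q \<Longrightarrow> a + b \<in> W \<longleftrightarrow> a \<in> U \<and> b \<in> V"
  shows "restrict_keys W (p * q) = restrict_keys U p * restrict_keys V q"
proof -
  have expand: "restrict_keys W r = (\<Sum>a\<in>keys r. restrict_keys W (single a (lookup r a)))"
    for W and r :: "'a \<Rightarrow>\<^sub>0 'k"
    by (simp flip: restrict_keys_sum add: poly_mapping_eq_sum_single[symmetric])
  show ?thesis
    unfolding expand[of U p] expand[of V q] sum_product times_eq_sum_single[of p q] restrict_keys_sum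
    by (intro sum.cong refl) (auto simp: restrict_keys_single mult_single assms)
qed

lemmas restrict_keys_times = restrict_keys_times_gen[of _ _ W W W for W]

text \<open>The linear extension of a map of monomials to polynomials.\<close>

definition push_keys :: "('a \<Rightarrow> 'b) \<Rightarrow> ('a \<Rightarrow>\<^sub>0 'k::comm_monoid_add) \<Rightarrow> 'b \<Rightarrow>\<^sub>0 'k" where
  "push_keys f p = (\<Sum>m\<in>keys p. single (f m) (lookup p m))"

lemma push_keys_eq_sum:
  assumes "finite A" "keys p \<subseteq> A"
  shows "push_keys f p = (\<Sum>m\<in>A. single (f m) (lookup p m))"
  unfolding push_keys_def using assms by (intro sum.mono_neutral_left) (auto simp: in_keys_iff)

lemma push_keys_0 [simp]: "push_keys f 0 = 0"
  by (simp add: push_keys_def)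

lemma push_keys_add: "push_keys f (p + q) = push_keys f p + push_keys f q"
proof -
  have "push_keys f r = (\<Sum>m\<in>keys p \<union> keys q. single (f m) (lookup r m))"
    if "r \<in> {p, q, p + q}" for r
    by (rule push_keys_eq_sum) (use that keys_add[of p q] in auto)
  then show ?thesis
    by (simp add: lookup_add single_add sum.distrib)
qed

lemma push_keys_single [simp]: "push_keys f (single m c) = single (f m) c"
  by (cases "c = 0") (simp_all add: push_keys_def)

lemma push_keys_sum: "push_keys f (sum g A) = (\<Sum>a\<in>A. push_keys f (g a))"
  by (induction A rule: infinite_finite_induct) (simp_all add: push_keys_add)

lemma keys_push_keys: "keys (push_keys f p) \<subseteq> f ` keys p"
proof
  fix k assume "k \<in> keys (push_keys f p)"
  then have "lookup (push_keys f p) k \<noteq> 0" by (simp add: in_keys_iff)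
  then obtain m where "m \<in> keys p" "lookup (single (f m) (lookup p m)) k \<noteq> 0"
    unfolding push_keys_def lookup_sum by (meson sum.neutral)
  then show "k \<in> f ` keys p" by (auto simp: lookup_single when_def split: if_splits)
qed

lemma push_keys_cong: "(\<And>m. m \<in> keys p \<Longrightarrow> f m = g m) \<Longrightarrow> push_keys f p = push_keys g p"
  by (simp add: push_keys_def)

lemma push_keys_ident: "(\<And>m. m \<in> keys p \<Longrightarrow> f m = m) \<Longrightarrow> push_keys f p = p"
  by (simp add: push_keys_def poly_mapping_eq_sum_single[symmetric])

lemma push_keys_push_keys: "push_keys f (push_keys g p) = push_keys (\<lambda>m. f (g m)) p"
  by (simp add: push_keys_def[of g] push_keys_sum) (simp add: push_keys_def)

lemma push_keys_times:
  fixes p q :: "'a::comm_monoid_add \<Rightarrow>\<^sub>0 'k::comm_ring_1" and f :: "'a \<Rightarrow> 'b::comm_monoid_add"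
  assumes "\<And>a b. a \<in> keys p \<Longrightarrow> b \<in> keys q \<Longrightarrow> f (a + b) = f a + f b"
  shows "push_keys f (p * q) = push_keys f p * push_keys f q"
  unfolding push_keys_def[of f p] push_keys_def[of f q] sum_product
    times_eq_sum_single[of p q] push_keys_sum
  by (intro sum.cong refl) (simp add: mult_single assms)

lemma restrict_keys_push_keys:
  "restrict_keys W (push_keys f p) = push_keys f (restrict_keys (f -` W) p)"
proof -
  have "push_keys f (restrict_keys (f -` W) p) =
      (\<Sum>m\<in>keys p. single (f m) (lookup (restrict_keys (f -` W) p) m))"
    by (rule push_keys_eq_sum) (auto simp: keys_restrict_keys)
  also have "\<dots> = (\<Sum>m\<in>keys p. restrict_keys W (single (f m) (lookup p m)))"
    by (intro sum.cong refl) (auto simp: lookup_restrict_keys restrict_keys_single)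
  finally show ?thesis by (simp add: push_keys_def[of f p] restrict_keys_sum)
qed

lemma push_keys_inj:
  fixes p q :: "'a \<Rightarrow>\<^sub>0 'k::comm_monoid_add"
  assumes "inj_on f K" "keys p \<subseteq> K" "keys q \<subseteq> K" "push_keys f p = push_keys f q"
  shows "p = q"
proof -
  have left_inverse: "push_keys (the_inv_into K f) (push_keys f r) = r" if "keys r \<subseteq> K" for r :: "'a \<Rightarrow>\<^sub>0 'k"
    unfolding push_keys_push_keys
    by (rule push_keys_ident) (use that assms(1) in \<open>auto simp: the_inv_into_f_f\<close>)
  show ?thesis using left_inverse[OF assms(2)] left_inverse[OF assms(3)] assms(4) by metis
qed

section \<open>Monomial substitutions\<close>

lemma lookup_of_nat_times: "lookup (of_nat k * e) i = k * lookup e i"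
  for e :: "'a::comm_monoid_add \<Rightarrow>\<^sub>0 nat"
  by (induction k) (simp_all add: distrib_right lookup_add)

lemma mono_poly_times: "mono_poly a * mono_poly b = mono_poly (a + b)"
  by (simp add: mono_poly_def mult_single)

lemma mono_poly_0 [simp]: "mono_poly 0 = 1"
  by (simp add: mono_poly_def)

lemma mono_poly_power: "mono_poly e ^ k = mono_poly (of_nat k * e)"
  for e :: "nat monomial"
  by (induction k) (simp_all add: mono_poly_times distrib_right)

lemma mono_poly_prod: "(\<Prod>a\<in>A. mono_poly (f a)) = mono_poly (\<Sum>a\<in>A. f a)"
  by (induction A rule: infinite_finite_induct) (simp_all add: mono_poly_times)

text \<open>The exponent of the image of the monomial \<open>m\<close> under the substitution of the monomial with exponent
\<open>e x\<close> for each variable \<open>x\<close>. The multiple of an exponent by a natural number is written as a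
product in the semiring \<^typ>\<open>nat \<Rightarrow>\<^sub>0 nat\<close>, so that the ring laws apply to it.\<close>

definition subst_exponent :: "('x \<Rightarrow> nat monomial) \<Rightarrow> 'x monomial \<Rightarrow> nat monomial" where
  "subst_exponent e m = (\<Sum>x\<in>keys m. of_nat (lookup m x) * e x)"

lemma subst_exponent_eq_sum:
  assumes "finite A" "keys m \<subseteq> A"
  shows "subst_exponent e m = (\<Sum>x\<in>A. of_nat (lookup m x) * e x)"
  unfolding subst_exponent_def using assms by (intro sum.mono_neutral_left) (auto simp: in_keys_iff)

lemma subst_exponent_0 [simp]: "subst_exponent e 0 = 0"
  by (simp add: subst_exponent_def)

lemma subst_exponent_add: "subst_exponent e (a + b) = subst_exponent e a + subst_exponent e b"
proof -
  have "subst_exponent e r = (\<Sum>x\<in>keys a \<union> keys b. of_nat (lookup r x) * e x)"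
    if "r \<in> {a, b, a + b}" for r
    by (rule subst_exponent_eq_sum) (use that keys_add[of a b] in auto)
  then show ?thesis
    by (simp add: lookup_add distrib_right sum.distrib)
qed

lemma lookup_subst_exponent:
  "lookup (subst_exponent e m) i = (\<Sum>x\<in>keys m. lookup m x * lookup (e x) i)"
  by (simp add: subst_exponent_def lookup_sum lookup_of_nat_times)

lemma subst_exponent_single: "subst_exponent e (single x c) = of_nat c * e x"
  by (cases "c = 0") (simp_all add: subst_exponent_def)

lemma subst_exponent_sum: "subst_exponent e (sum h A) = (\<Sum>a\<in>A. subst_exponent e (h a))"
  by (induction A rule: infinite_finite_induct) (simp_all add: subst_exponent_add)

lemma subst_exponent_push_keys:
  "subst_exponent e (push_keys g m) = subst_exponent (\<lambda>x. e (g x)) m"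
  by (simp add: push_keys_def subst_exponent_sum subst_exponent_single) (simp add: subst_exponent_def)

text \<open>A substitution of monomials is a push-forward along an additive map of exponents. This turns
questions about toric rings into questions about exponents.\<close>

lemma poly_subst_mono_poly:
  "poly_subst (\<lambda>x. mono_poly (e x)) p = push_keys (subst_exponent e) p"
  unfolding poly_subst_def push_keys_def
  by (intro sum.cong refl)
    (simp add: mono_poly_power mono_poly_prod subst_exponent_def, simp add: mono_poly_def const_poly_def mult_single)

definition toric_exponent :: "nat \<Rightarrow> (nat \<Rightarrow> nat) \<Rightarrow> nat monomial" where
  "toric_exponent n u = (\<Sum>i=1..n. single i (u i)) + single 0 1"

lemma lookup_toric_exponent:
  "lookup (toric_exponent n u) i = (if i = 0 then 1 else if i \<le> n then u i else 0)"
proof -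
  have "(\<Sum>j=1..n. lookup (single j (u j)) i) = (\<Sum>j=1..n. if j = i then u j else 0)"
    by (intro sum.cong refl) (auto simp: lookup_single when_def)
  then show ?thesis
    by (auto simp: toric_exponent_def lookup_add lookup_sum lookup_single when_def sum.delta)
qed

lemma toric_gen_eq_mono_poly:
  "toric_gen n u = (mono_poly (toric_exponent n u) :: (nat, 'k::field) mpoly)"
proof -
  have "of_nat k * single i 1 = single i k" for i k :: nat
    by (rule poly_mapping_eqI) (simp add: lookup_of_nat_times lookup_single when_def)
  then have "(var_poly i :: (nat, 'k) mpoly) ^ k = mono_poly (single i k)" for i k
    by (simp only: var_poly_def mono_poly_power)
  then show ?thesis
    by (simp only: toric_gen_def mono_poly_prod mono_poly_times toric_exponent_def var_poly_def[of 0])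
qed

abbreviation toric_monomial :: "nat \<Rightarrow> (nat \<Rightarrow> nat) monomial \<Rightarrow> nat monomial" where
  "toric_monomial n \<equiv> subst_exponent (toric_exponent n)"

lemma poly_subst_toric_gen:
  "poly_subst (toric_gen n) = (push_keys (toric_monomial n) :: (_, 'k::field) mpoly \<Rightarrow> _)"
proof -
  have "toric_gen n = (\<lambda>u. mono_poly (toric_exponent n u) :: (nat, 'k) mpoly)"
    by (rule ext) (rule toric_gen_eq_mono_poly)
  from arg_cong[OF this, of poly_subst] show ?thesis
    by (rule trans) (rule ext, rule poly_subst_mono_poly)
qed

section \<open>Ideals of polynomial rings and setting variables to zero\<close>

lemma monomials_0 [simp]: "0 \<in> monomials S"
  by (simp add: monomials_def)

lemma add_in_monomials_iff: "a + b \<in> monomials S \<longleftrightarrow> a \<in> monomials S \<and> b \<in> monomials S"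
  for a b :: "'x monomial"
  by (auto simp: monomials_def subset_iff in_keys_iff lookup_add)

lemma monomials_mono: "S \<subseteq> T \<Longrightarrow> monomials S \<subseteq> monomials T"
  by (auto simp: monomials_def)

lemma cring_of_type_class:
  fixes R :: "('a::comm_ring_1, 'm) ring_scheme"
  assumes ops: "monoid.mult R = (*)" "one R = 1" "zero R = 0" "add R = (+)"
    and closed: "1 \<in> carrier R" "0 \<in> carrier R"
      "\<And>a b. a \<in> carrier R \<Longrightarrow> b \<in> carrier R \<Longrightarrow> a + b \<in> carrier R"
      "\<And>a b. a \<in> carrier R \<Longrightarrow> b \<in> carrier R \<Longrightarrow> a * b \<in> carrier R"
      "\<And>a. a \<in> carrier R \<Longrightarrow> - a \<in> carrier R"
  shows "cring R"
proof (rule cringI)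
  show "abelian_group R"
  proof (rule abelian_groupI)
    show "\<exists>y\<in>carrier R. y \<oplus>\<^bsub>R\<^esub> x = \<zero>\<^bsub>R\<^esub>" if "x \<in> carrier R" for x
      using that closed(5) by (intro bexI[of _ "- x"]) (auto simp: ops)
  qed (auto simp: ops closed algebra_simps)
  show "comm_monoid R"
    by (rule comm_monoidI) (auto simp: ops closed algebra_simps)
qed (auto simp: ops algebra_simps)

lemma polys_closed:
  "0 \<in> polys S" "1 \<in> polys S"
  "p \<in> polys S \<Longrightarrow> q \<in> polys S \<Longrightarrow> p + q \<in> polys S"
  "p \<in> polys S \<Longrightarrow> q \<in> polys S \<Longrightarrow> p * q \<in> polys S"
  "p \<in> polys S \<Longrightarrow> - p \<in> polys S"
proof -
  assume "p \<in> polys S" "q \<in> polys S"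
  then show "p * q \<in> polys S"
    using keys_mult[of p q] by (fastforce simp: polys_def add_in_monomials_iff)
qed (use keys_add[of p q] in \<open>auto simp: polys_def in_keys_iff\<close>)

lemma poly_ring_simps [simp]:
  "carrier (poly_ring S) = polys S" "monoid.mult (poly_ring S) = (*)" "one (poly_ring S) = 1"
  "zero (poly_ring S) = 0" "add (poly_ring S) = (+)"
  by (simp_all add: poly_ring_def ring_of_type_algebra_def)

lemma cring_poly_ring: "cring (poly_ring S)"
  by (rule cring_of_type_class) (auto simp: polys_closed)

lemma ring_poly_ring: "ring (poly_ring S)"
  using cring_poly_ring cring_def by blast

lemma genideal_subset_iff:
  assumes "ideal I (poly_ring S)"
  shows "genideal (poly_ring S) G \<subseteq> I \<longleftrightarrow> G \<subseteq> I"
  using assms unfolding genideal_def by blast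

lemma ideal_genideal: "G \<subseteq> polys S \<Longrightarrow> ideal (genideal (poly_ring S) G) (poly_ring S)"
  using ring.genideal_ideal[OF ring_poly_ring] by simp

lemma polys_mono: "S \<subseteq> T \<Longrightarrow> polys S \<subseteq> polys T"
  using monomials_mono by (force simp: polys_def)

lemma restrict_monomials_in_polys: "restrict_keys (monomials S) p \<in> polys S"
  by (simp add: polys_def keys_restrict_keys)

lemma restrict_monomials_id: "p \<in> polys S \<Longrightarrow> restrict_keys (monomials S) p = p"
  by (simp add: polys_def restrict_keys_id)

lemma ring_hom_restrict_monomials:
  "ring_hom_ring (poly_ring S) (poly_ring T :: (_, 'k::field) mpoly ring) (restrict_keys (monomials T))"
  by (rule ring_hom_ringI[OF ring_poly_ring ring_poly_ring])
     (auto simp: restrict_monomials_in_polys restrict_keys_add restrict_keys_times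
       add_in_monomials_iff restrict_monomials_id polys_closed)

text \<open>Dropping all monomials outside \<open>monomials T\<close> sets the variables outside \<open>T\<close> to zero. Being a ring
homomorphism, it maps an ideal into the ideal generated by the images of the generators.\<close>

lemma restrict_monomials_genideal:
  fixes G :: "('x, 'k::field) mpoly set"
  assumes "G \<subseteq> polys S"
  shows "restrict_keys (monomials T) ` genideal (poly_ring S) G
    \<subseteq> genideal (poly_ring T) (restrict_keys (monomials T) ` G)"
proof -
  let ?\<pi> = "restrict_keys (monomials T)"
  let ?J = "genideal (poly_ring T) (?\<pi> ` G)"
  have J: "ideal ?J (poly_ring T)"
    by (rule ideal_genideal) (auto simp: restrict_monomials_in_polys)
  have "G \<subseteq> {p \<in> polys S. ?\<pi> p \<in> ?J}"
    using assms by (auto simp: genideal_def)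
  moreover have "ideal {p \<in> polys S. ?\<pi> p \<in> ?J} (poly_ring S)"
    using ring_hom_ring.ideal_vimage[OF ring_hom_restrict_monomials J] by simp
  ultimately have "genideal (poly_ring S) G \<subseteq> {p \<in> polys S. ?\<pi> p \<in> ?J}"
    by (simp only: genideal_subset_iff)
  then show ?thesis by blast
qed

lemma ideal_defining_ideal: "ideal (defining_ideal n S :: (_, 'k::field) mpoly set) (poly_ring S)"
proof -
  have "ring_hom_ring (poly_ring S) (poly_ring UNIV)
      (poly_subst (toric_gen n) :: (_, 'k) mpoly \<Rightarrow> _)"
    by (rule ring_hom_ringI[OF ring_poly_ring ring_poly_ring])
       (auto simp: poly_subst_toric_gen push_keys_add push_keys_times subst_exponent_add
         polys_def monomials_def simp flip: single_one)
  moreover have "ideal {0} (poly_ring UNIV :: (nat, 'k) mpoly ring)"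
    using ring.zeroideal[OF ring_poly_ring, of UNIV] by simp
  ultimately have "ideal {p \<in> carrier (poly_ring S). poly_subst (toric_gen n) p \<in> {0}}
      (poly_ring S :: (_, 'k) mpoly ring)"
    by (rule ring_hom_ring.ideal_vimage)
  then show ?thesis by (simp add: defining_ideal_def)
qed

section \<open>Faces: quadratic relations and quadratic Groebner bases\<close>

text \<open>The set \<open>W\<close> cuts out a face of the monoid of exponents of \<open>K[S]\<close>: a product of generators lies in
\<open>W\<close> if and only if every factor comes from \<open>T\<close>. The subalgebra \<open>K[T]\<close> is then spanned by the monomials
of \<open>K[S]\<close> in \<open>W\<close>.\<close>

locale toric_face =
  fixes n :: nat and S T :: "(nat \<Rightarrow> nat) set" and W :: "nat monomial set"
  assumes subset: "T \<subseteq> S"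
    and face: "m \<in> monomials S \<Longrightarrow> toric_monomial n m \<in> W \<longleftrightarrow> m \<in> monomials T"
begin

text \<open>Setting the variables outside \<open>T\<close> to zero induces on \<open>K[S]\<close> the removal of all monomials outside
the face. In particular it maps the defining ideal of \<open>K[S]\<close> to that of \<open>K[T]\<close>.\<close>

lemma restrict_face:
  assumes "p \<in> polys S"
  shows "restrict_keys W (push_keys (toric_monomial n) p) =
    push_keys (toric_monomial n) (restrict_keys (monomials T) p)"
  unfolding restrict_keys_push_keys
  using assms face by (auto simp: polys_def intro!: arg_cong[where f = "push_keys _"] restrict_keys_cong)

lemma restrict_defining_ideal:
  assumes "p \<in> defining_ideal n S"
  shows "restrict_keys (monomials T) p \<in> defining_ideal n T"
  using assms by (simp add: defining_ideal_def poly_subst_toric_gen restrict_monomials_in_polys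
    flip: restrict_face)

lemma defining_ideal_subset: "defining_ideal n T \<subseteq> defining_ideal n S"
  using polys_mono[OF subset] by (auto simp: defining_ideal_def)

text \<open>The defining ideal of \<open>K[T]\<close> is the image of that of \<open>K[S]\<close> when the variables outside \<open>T\<close> are set
to zero, so the images of quadratic generators generate it.\<close>

lemma quadratically_generated_face:
  assumes "quadratically_generated S (defining_ideal n S :: (_, 'k::field) mpoly set)"
  shows "quadratically_generated T (defining_ideal n T :: (_, 'k) mpoly set)"
proof -
  let ?\<pi> = "restrict_keys (monomials T)"
  obtain G :: "(_, 'k) mpoly set" where G: "G \<subseteq> polys S" "\<forall>g\<in>G. quadratic g" and
    gen: "defining_ideal n S = genideal (poly_ring S) G"
    using assms by (auto simp: quadratically_generated_def)
  (* A generator may project to 0, which does not count as quadratic. *)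
  define G' where "G' = ?\<pi> ` G - {0}"
  have G'_polys: "G' \<subseteq> polys T" by (auto simp: G'_def restrict_monomials_in_polys)
  note ideal_G' = ideal_genideal[OF G'_polys]
  have "quadratic g" if "g \<in> G'" for g
    using that G(2) by (auto simp: G'_def quadratic_def keys_restrict_keys)
  moreover have "defining_ideal n T \<subseteq> genideal (poly_ring T) G'"
  proof
    fix p :: "(_, 'k) mpoly" assume p: "p \<in> defining_ideal n T"
    then have "?\<pi> p \<in> genideal (poly_ring T) (?\<pi> ` G)"
      using defining_ideal_subset gen restrict_monomials_genideal[OF G(1), of T] by blast
    moreover have "?\<pi> ` G \<subseteq> genideal (poly_ring T) G'"
    proof -
      have "?\<pi> ` G \<subseteq> insert 0 G'" by (auto simp: G'_def)
      moreover have "0 \<in> genideal (poly_ring T) G'"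
        using additive_subgroup.zero_closed[OF ideal.axioms(1)[OF ideal_G']] by simp
      moreover have "G' \<subseteq> genideal (poly_ring T) G'" by (auto simp: genideal_def)
      ultimately show ?thesis by (meson insert_subsetI subset_trans)
    qed
    ultimately show "p \<in> genideal (poly_ring T) G'"
      using p genideal_subset_iff[OF ideal_G'] restrict_monomials_id[of p T]
      by (auto simp: defining_ideal_def)
  qed
  moreover have "genideal (poly_ring T) G' \<subseteq> defining_ideal n T"
  proof -
    have "G \<subseteq> defining_ideal n S" unfolding gen by (auto simp: genideal_def)
    then show ?thesis
      unfolding genideal_subset_iff[OF ideal_defining_ideal] G'_def using restrict_defining_ideal by blast
  qed
  ultimately show ?thesis
    using G'_polys unfolding quadratically_generated_def by (intro exI[of _ G']) auto
qed

end

lemma genideal_self: "G \<subseteq> genideal (poly_ring S) G"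
  by (auto simp: genideal_def)

lemma lead_mono_in_lead_ideal:
  "f \<in> F \<Longrightarrow> f \<noteq> 0 \<Longrightarrow> mono_poly (lead_mono ord f) \<in> lead_ideal S ord F"
  unfolding lead_ideal_def by (rule subsetD[OF genideal_self]) auto

lemma lead_mono_eqI:
  assumes "antisym ord" "m \<in> keys p" "\<And>k. k \<in> keys p \<Longrightarrow> (k, m) \<in> ord"
  shows "lead_mono ord p = m"
  unfolding lead_mono_def using assms by (intro the_equality) (auto dest: antisymD)

lemma finite_linear_order_has_max:
  assumes "linear_order_on M ord" "finite A" "A \<noteq> {}" "A \<subseteq> M"
  shows "\<exists>m\<in>A. \<forall>a\<in>A. (a, m) \<in> ord"
  using assms(2-4)
proof (induction A rule: finite_ne_induct)
  case (singleton x)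
  then show ?case using assms(1) by (auto simp: order_on_defs refl_on_def)
next
  case (insert x F)
  then obtain m where m: "m \<in> F" "\<forall>a\<in>F. (a, m) \<in> ord" by auto
  have refl: "(x, x) \<in> ord" and total: "(x, m) \<in> ord \<or> (m, x) \<in> ord" and trans: "trans ord"
    using assms(1) insert.prems subsetD[OF insert.prems, of m] m(1)
    by (cases "x = m"; force simp: order_on_defs refl_on_def total_on_def)+
  show ?case
  proof (cases "(x, m) \<in> ord")
    case True
    then show ?thesis using m by blast
  next
    case False
    then have "(m, x) \<in> ord" using total by simp
    then show ?thesis using m refl transD[OF trans] by blast
  qed
qed

lemma lead_mono_props:
  assumes "term_order S ord" "p \<in> polys S" "p \<noteq> 0"
  shows "lead_mono ord p \<in> keys p" and "m \<in> keys p \<Longrightarrow> (m, lead_mono ord p) \<in> ord"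
proof -
  have lin: "linear_order_on (monomials S) ord" using assms(1) by (simp add: term_order_def)
  obtain l where l: "l \<in> keys p" "\<forall>m\<in>keys p. (m, l) \<in> ord"
    using finite_linear_order_has_max[OF lin, of "keys p"] assms(2,3) by (auto simp: polys_def)
  have "antisym ord" using lin by (simp add: order_on_defs)
  then have "lead_mono ord p = l" using l by (intro lead_mono_eqI) auto
  then show "lead_mono ord p \<in> keys p" "m \<in> keys p \<Longrightarrow> (m, lead_mono ord p) \<in> ord" using l by auto
qed

definition restrict_order :: "'x set \<Rightarrow> ('x monomial \<times> 'x monomial) set \<Rightarrow> ('x monomial \<times> 'x monomial) set" where
  "restrict_order T ord = ord \<inter> monomials T \<times> monomials T"

lemma term_order_restrict:
  assumes "term_order S ord" "T \<subseteq> S"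
  shows "term_order T (restrict_order T ord)"
proof -
  have sub: "monomials T \<subseteq> monomials S" using monomials_mono[OF assms(2)] .
  have "linear_order_on (monomials T) (restrict_order T ord)"
    using assms(1) sub
    unfolding term_order_def order_on_defs restrict_order_def refl_on_def total_on_def trans_def antisym_def
    by blast
  then show ?thesis
    using assms(1) sub
    by (auto simp: term_order_def restrict_order_def add_in_monomials_iff subset_iff)
qed

text \<open>If the leading monomial survives the removal of variables, it remains the leading one, because the
other monomials that survive were smaller before.\<close>

lemma lead_mono_restrict:
  assumes "term_order S ord" "T \<subseteq> S" "g \<in> polys S" "g \<noteq> 0" "lead_mono ord g \<in> monomials T"
  shows "lead_mono (restrict_order T ord) (restrict_keys (monomials T) g) = lead_mono ord g"
proof (rule lead_mono_eqI)
  show "antisym (restrict_order T ord)"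
    using term_order_restrict[OF assms(1,2)] by (simp add: term_order_def order_on_defs)
qed (use assms lead_mono_props[OF assms(1,3,4)] in \<open>auto simp: keys_restrict_keys restrict_order_def\<close>)

context toric_face
begin

text \<open>The projections of the Groebner basis are again a Groebner basis. Let \<open>f\<close> be in the ideal of
\<open>K[T]\<close>. Its leading monomial lies in the ideal generated by the leading monomials of the old basis and
involves only variables in \<open>T\<close>; setting the other variables to zero leaves exactly those leading
monomials that involve only variables in \<open>T\<close>, and these are leading monomials of projections.\<close>

lemma quadratic_groebner_basis_face:
  assumes "has_quadratic_groebner_basis S (defining_ideal n S :: (_, 'k::field) mpoly set)"
  shows "has_quadratic_groebner_basis T (defining_ideal n T :: (_, 'k) mpoly set)"
proof -
  let ?\<pi> = "restrict_keys (monomials T)"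
  let ?I = "\<lambda>S. defining_ideal n S :: (_, 'k) mpoly set"
  obtain ord and G :: "(_, 'k) mpoly set" where ord: "term_order S ord" and
    G: "finite G" "G \<subseteq> ?I S" "lead_ideal S ord G = lead_ideal S ord (?I S)" "\<forall>g\<in>G. quadratic g"
    using assms by (auto simp: has_quadratic_groebner_basis_def groebner_basis_def)
  let ?leads = "{mono_poly (lead_mono ord g) :: (_, 'k) mpoly |g. g \<in> G \<and> g \<noteq> 0}"
  define ord' where "ord' = restrict_order T ord"
  define G' where "G' = ?\<pi> ` G - {0}"
  have ord': "term_order T ord'" unfolding ord'_def using ord subset by (rule term_order_restrict)
  have I_polys: "?I S \<subseteq> polys S" for S by (auto simp: defining_ideal_def)
  have G': "finite G'" "G' \<subseteq> ?I T" "\<forall>g\<in>G'. quadratic g"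
    using G restrict_defining_ideal by (auto simp: G'_def quadratic_def keys_restrict_keys)
  have leads_polys: "{mono_poly (lead_mono ord f) |f. f \<in> F \<and> f \<noteq> 0} \<subseteq> (polys S :: (_, 'k) mpoly set)"
    if "term_order S ord" "F \<subseteq> polys S" for S ord and F :: "(nat \<Rightarrow> nat, 'k) mpoly set"
    using lead_mono_props(1)[OF that(1)] that(2) by (fastforce simp: polys_def mono_poly_def)
  have G_polys: "G \<subseteq> polys S" using G(2) I_polys by blast
  have ideal_G': "ideal (lead_ideal T ord' G') (poly_ring T)"
    unfolding lead_ideal_def using G'(2) I_polys ord' by (intro ideal_genideal leads_polys) auto
  have "lead_ideal T ord' G' \<subseteq> lead_ideal T ord' (?I T)"
    unfolding lead_ideal_def genideal_def using G'(2) by blast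
  moreover have "lead_ideal T ord' (?I T) \<subseteq> lead_ideal T ord' G'"
  proof -
    have pi_leads: "?\<pi> (mono_poly (lead_mono ord g)) \<in> lead_ideal T ord' G'"
      if "g \<in> G" "g \<noteq> 0" for g
    proof (cases "lead_mono ord g \<in> monomials T")
      case True
      have g: "g \<in> polys S" using that G(2) I_polys by blast
      have "lead_mono ord g \<in> keys (?\<pi> g)"
        using lead_mono_props(1)[OF ord g that(2)] True by (simp add: keys_restrict_keys)
      then have "?\<pi> g \<in> G'" "?\<pi> g \<noteq> 0" using that by (auto simp: G'_def)
      moreover have "lead_mono ord' (?\<pi> g) = lead_mono ord g"
        unfolding ord'_def by (rule lead_mono_restrict[OF ord subset g that(2) True])
      ultimately have "mono_poly (lead_mono ord g) \<in> lead_ideal T ord' G'"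
        using lead_mono_in_lead_ideal by metis
      then show ?thesis using True by (simp add: mono_poly_def restrict_keys_single)
    next
      case False
      then show ?thesis
        using additive_subgroup.zero_closed[OF ideal.axioms(1)[OF ideal_G']]
        by (simp add: mono_poly_def restrict_keys_single)
    qed
    have "mono_poly (lead_mono ord' f) \<in> lead_ideal T ord' G'" if "f \<in> ?I T" "f \<noteq> 0" for f
    proof -
      have f: "f \<in> ?I S" "f \<in> polys T" "f \<in> polys S" using that defining_ideal_subset I_polys by blast+
      have in_T: "lead_mono ord f \<in> monomials T"
        using lead_mono_props(1)[OF ord f(3) that(2)] f(2) by (auto simp: polys_def)
      have eq: "lead_mono ord' f = lead_mono ord f"
        using lead_mono_restrict[OF ord subset f(3) that(2) in_T]
        by (simp add: ord'_def restrict_monomials_id f(2))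
      have "mono_poly (lead_mono ord f) \<in> lead_ideal S ord G"
        unfolding G(3) using f(1) that(2) by (rule lead_mono_in_lead_ideal)
      then have "?\<pi> (mono_poly (lead_mono ord f)) \<in> ?\<pi> ` lead_ideal S ord G" by (rule imageI)
      then have "?\<pi> (mono_poly (lead_mono ord f))
          \<in> genideal (poly_ring T) (?\<pi> ` ?leads)"
        unfolding lead_ideal_def
        by (rule subsetD[OF restrict_monomials_genideal[OF leads_polys[OF ord G_polys]]])
      moreover have "genideal (poly_ring T) (?\<pi> ` ?leads)
          \<subseteq> lead_ideal T ord' G'"
        unfolding genideal_subset_iff[OF ideal_G'] using pi_leads by blast
      ultimately have "?\<pi> (mono_poly (lead_mono ord f)) \<in> lead_ideal T ord' G'"
        by (rule subsetD[rotated])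
      then show ?thesis using in_T unfolding eq by (simp add: mono_poly_def restrict_keys_single)
    qed
    then have "{mono_poly (lead_mono ord' f) |f. f \<in> ?I T \<and> f \<noteq> 0} \<subseteq> lead_ideal T ord' G'"
      by blast
    then show ?thesis
      unfolding lead_ideal_def[of T ord' "?I T"] genideal_subset_iff[OF ideal_G'] .
  qed
  ultimately have "groebner_basis T ord' (?I T) G'"
    using G' by (simp add: groebner_basis_def)
  then show ?thesis using ord' G'(3) unfolding has_quadratic_groebner_basis_def by blast
qed

end

section \<open>Splitting idempotent matrices\<close>

definition mat_mult :: "nat \<Rightarrow> (nat \<Rightarrow> nat \<Rightarrow> 'a::comm_ring_1) \<Rightarrow> (nat \<Rightarrow> nat \<Rightarrow> 'a) \<Rightarrow> nat \<Rightarrow> nat \<Rightarrow> 'a" where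
  "mat_mult b M N = (\<lambda>j l. \<Sum>k<b. M j k * N k l)"

definition mat_one :: "nat \<Rightarrow> nat \<Rightarrow> nat \<Rightarrow> 'a::comm_ring_1" where
  "mat_one r = (\<lambda>j k. if j = k \<and> j < r then 1 else 0)"

text \<open>Matrices of all sizes live in one function type; entries outside the intended size are 0. In this way
matrix identities are equalities of functions.\<close>

definition supported :: "nat \<Rightarrow> nat \<Rightarrow> (nat \<Rightarrow> nat \<Rightarrow> 'a::zero) \<Rightarrow> bool" where
  "supported r c M \<longleftrightarrow> (\<forall>j k. r \<le> j \<or> c \<le> k \<longrightarrow> M j k = 0)"

lemma supported_mat_one: "supported r r (mat_one r)"
  by (simp add: supported_def mat_one_def)

lemma mat_mult_assoc: "mat_mult c (mat_mult b M N) L = mat_mult b M (mat_mult c N L)"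
proof (intro ext)
  fix j l
  have "(\<Sum>k<c. \<Sum>i<b. M j i * N i k * L k l) = (\<Sum>i<b. \<Sum>k<c. M j i * N i k * L k l)"
    by (rule sum.swap)
  then show "mat_mult c (mat_mult b M N) L j l = mat_mult b M (mat_mult c N L) j l"
    by (simp add: mat_mult_def sum_distrib_left sum_distrib_right mult.assoc)
qed

lemma mat_one_left: "(\<And>j l. r \<le> j \<Longrightarrow> M j l = 0) \<Longrightarrow> mat_mult r (mat_one r) M = M"
proof (intro ext)
  fix j l
  assume M: "\<And>j l. r \<le> j \<Longrightarrow> M j l = 0"
  have "mat_mult r (mat_one r) M j l = (\<Sum>k<r. if k = j then M j l else 0)"
    unfolding mat_mult_def mat_one_def by (intro sum.cong) auto
  then show "mat_mult r (mat_one r) M j l = M j l" using M by (auto simp: not_less)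
qed

lemma mat_mult_zero_right [simp]: "mat_mult b M (\<lambda>j l. 0) = (\<lambda>j l. 0)"
  by (simp add: mat_mult_def)

lemma supported_mat_mult: "supported r b M \<Longrightarrow> supported b' c N \<Longrightarrow> supported r c (mat_mult k M N)"
  by (auto simp: supported_def mat_mult_def)

text \<open>An idempotent matrix over a field is the projection onto a direct summand, which has a basis: \<open>Q\<close> is the
inclusion of that summand in coordinates, and \<open>S\<close> the projection.\<close>

lemma idempotent_matrix_split:
  fixes p :: "nat \<Rightarrow> nat \<Rightarrow> 'k::field"
  assumes supp: "supported b b p" and idem: "mat_mult b p p = p"
  obtains c Q S where "supported b c Q" "supported c b S" "mat_mult c Q S = p"
    "mat_mult b S Q = mat_one c"
proof -
  (* Columns of Q that span the image of p are indexed by L; a smallest L makes them independent. *)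
  define factors where "factors L Q S \<longleftrightarrow> finite L \<and> (\<forall>j k. (\<Sum>l\<in>L. Q j l * S l k) = p j k) \<and>
    mat_mult b p Q = Q" for L :: "nat set" and Q S
  have "factors {..<b} p p" using idem by (auto simp: factors_def mat_mult_def fun_eq_iff)
  then obtain L Q S where fac: "factors L Q S" and
    minimal: "\<And>L' Q' S'. factors L' Q' S' \<Longrightarrow> card L \<le> card L'"
    using exists_least_iff[of "\<lambda>c. \<exists>L Q S. factors L Q S \<and> card L = c"]
    by (metis not_less)
  have "finite L" and QS: "\<And>j k. (\<Sum>l\<in>L. Q j l * S l k) = p j k" and pQ: "mat_mult b p Q = Q"
    using fac by (auto simp: factors_def)
  have SQ: "(\<Sum>k<b. S l k * Q k m) = (if l = m then 1 else 0)" if "l \<in> L" "m \<in> L" for l m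
  proof (rule ccontr)
    assume neq: "(\<Sum>k<b. S l k * Q k m) \<noteq> (if l = m then 1 else 0)"
    (* A nonzero entry of SQ - 1 gives a linear relation between the columns of Q, so column l is redundant. *)
    define x where "x i = (\<Sum>k<b. S i k * Q k m) - (if i = m then 1 else 0)" for i
    have x: "x l \<noteq> 0" using neq by (simp add: x_def)
    have dependent: "(\<Sum>i\<in>L. Q j i * x i) = 0" for j
    proof -
      have "(\<Sum>i\<in>L. Q j i * (\<Sum>k<b. S i k * Q k m)) = (\<Sum>i\<in>L. \<Sum>k<b. Q j i * S i k * Q k m)"
        by (simp add: sum_distrib_left mult.assoc)
      also have "\<dots> = (\<Sum>k<b. \<Sum>i\<in>L. Q j i * S i k * Q k m)" by (rule sum.swap)
      also have "\<dots> = mat_mult b p Q j m"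
        by (simp add: mat_mult_def QS flip: sum_distrib_right)
      finally have "(\<Sum>i\<in>L. Q j i * (\<Sum>k<b. S i k * Q k m)) = Q j m" by (simp add: pQ)
      moreover have "(\<Sum>i\<in>L. Q j i * (if i = m then 1 else 0)) = Q j m"
        using \<open>finite L\<close> that(2) by (simp add: sum.delta if_distrib[of "\<lambda>y. _ * y"] cong: if_cong)
      ultimately show ?thesis by (simp add: x_def right_diff_distrib sum_subtractf)
    qed
    define S' where "S' i k = S i k - x i / x l * S l k" for i k
    have "factors (L - {l}) Q S'"
      unfolding factors_def
    proof (intro conjI allI)
      fix j k
      have "(\<Sum>i\<in>L. Q j i * S' i k) = (\<Sum>i\<in>L. Q j i * S i k) - (\<Sum>i\<in>L. Q j i * x i) / x l * S l k"
        by (simp add: S'_def right_diff_distrib sum_subtractf sum_divide_distrib sum_distrib_right mult.assoc)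
      then have "(\<Sum>i\<in>L. Q j i * S' i k) = p j k" by (simp add: dependent QS)
      moreover have "S' l k = 0" using x by (simp add: S'_def)
      ultimately show "(\<Sum>i\<in>L - {l}. Q j i * S' i k) = p j k"
        using \<open>finite L\<close> that(1) by (simp add: sum.remove)
    qed (use \<open>finite L\<close> pQ in auto)
    from minimal[OF this] show False
      using \<open>finite L\<close> that(1) by (metis card_Diff1_less not_less)
  qed
  obtain e where e: "bij_betw e {..<card L} L"
    using ex_bij_betw_nat_finite[OF \<open>finite L\<close>] by (auto simp: atLeast0LessThan)
  have e_in: "e i \<in> L" if "i < card L" for i using bij_betwE[OF e] that by auto
  define Q' S' where "Q' = (\<lambda>j i. if j < b \<and> i < card L then Q j (e i) else 0)"
    and "S' = (\<lambda>i k. if i < card L \<and> k < b then S (e i) k else 0)"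
  have "mat_mult (card L) Q' S' = p"
  proof (intro ext)
    fix j k
    show "mat_mult (card L) Q' S' j k = p j k"
    proof (cases "j < b \<and> k < b")
      case True
      then have "mat_mult (card L) Q' S' j k = (\<Sum>i<card L. Q j (e i) * S (e i) k)"
        by (simp add: mat_mult_def Q'_def S'_def)
      also have "\<dots> = (\<Sum>l\<in>L. Q j l * S l k)" by (rule sum.reindex_bij_betw[OF e])
      finally show ?thesis by (simp add: QS)
    next
      case False
      then show ?thesis using supp by (auto simp: mat_mult_def Q'_def S'_def supported_def)
    qed
  qed
  moreover have "mat_mult b S' Q' = mat_one (card L)"
  proof (intro ext)
    fix i j
    show "mat_mult b S' Q' i j = mat_one (card L) i j"
    proof (cases "i < card L \<and> j < card L")
      case True
      then have "mat_mult b S' Q' i j = (if e i = e j then 1 else 0)"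
        using SQ[OF e_in e_in, of i j] by (simp add: mat_mult_def Q'_def S'_def)
      then show ?thesis using True e by (auto simp: mat_one_def bij_betw_def inj_on_def)
    qed (auto simp: mat_mult_def Q'_def S'_def mat_one_def)
  qed
  moreover have "supported b (card L) Q'" "supported (card L) b S'"
    by (auto simp: supported_def Q'_def S'_def)
  ultimately show ?thesis using that by blast
qed

section \<open>Graded algebras of polynomials\<close>

text \<open>Graded subalgebras of a monoid algebra, the monoid being graded by \<open>\<delta>\<close>. Their operations are those of
the ambient type, so that sums and products are computed there.\<close>

definition graded_alg ::
  "('m::comm_monoid_add \<Rightarrow> nat) \<Rightarrow> ('m \<Rightarrow>\<^sub>0 'k::field) set \<Rightarrow> ('k, 'm \<Rightarrow>\<^sub>0 'k) graded_algebra" where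
  "graded_alg \<delta> C = \<lparr>carrier = C, monoid.mult = (*), one = 1, ring.zero = 0, add = (+),
     module.smult = (\<lambda>c f. single 0 c * f), homog = (\<lambda>i. {f \<in> C. \<forall>m\<in>keys f. \<delta> m = i})\<rparr>"

lemma graded_alg_simps [simp]:
  "carrier (graded_alg \<delta> C) = C" "monoid.mult (graded_alg \<delta> C) = (*)" "one (graded_alg \<delta> C) = 1"
  "zero (graded_alg \<delta> C) = 0" "add (graded_alg \<delta> C) = (+)"
  "module.smult (graded_alg \<delta> C) = (\<lambda>c f. single 0 c * f)"
  "homog (graded_alg \<delta> C) = (\<lambda>i. {f \<in> C. \<forall>m\<in>keys f. \<delta> m = i})"
  by (simp_all add: graded_alg_def)

locale graded_subalgebra =
  fixes \<delta> :: "'m::comm_monoid_add \<Rightarrow> nat" and C :: "('m \<Rightarrow>\<^sub>0 'k::field) set"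
  assumes delta_add: "\<delta> (a + b) = \<delta> a + \<delta> b"
    and const_closed: "single 0 c \<in> C"
    and add_closed: "f \<in> C \<Longrightarrow> g \<in> C \<Longrightarrow> f + g \<in> C"
    and mult_closed: "f \<in> C \<Longrightarrow> g \<in> C \<Longrightarrow> f * g \<in> C"
    and component_closed: "f \<in> C \<Longrightarrow> restrict_keys {m. \<delta> m = i} f \<in> C"
    and degree_0: "f \<in> C \<Longrightarrow> (\<And>m. m \<in> keys f \<Longrightarrow> \<delta> m = 0) \<Longrightarrow> \<exists>c. f = single 0 c"
begin

abbreviation alg :: "('k, 'm \<Rightarrow>\<^sub>0 'k) graded_algebra" where "alg \<equiv> graded_alg \<delta> C"

definition component :: "nat \<Rightarrow> ('m \<Rightarrow>\<^sub>0 'k) \<Rightarrow> 'm \<Rightarrow>\<^sub>0 'k" where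
  "component i = restrict_keys {m. \<delta> m = i}"

definition homogeneous :: "nat \<Rightarrow> ('m \<Rightarrow>\<^sub>0 'k) set" where
  "homogeneous i = {f \<in> C. \<forall>m\<in>keys f. \<delta> m = i}"

lemma zero_closed: "0 \<in> C" and one_closed: "1 \<in> C"
  using const_closed[of 0] const_closed[of 1] by simp_all

lemma uminus_closed: "f \<in> C \<Longrightarrow> - f \<in> C"
  using mult_closed[OF const_closed[of "-1"], of f] by (simp add: single_uminus)

lemma sum_closed: "(\<And>a. a \<in> A \<Longrightarrow> f a \<in> C) \<Longrightarrow> sum f A \<in> C"
  by (induction A rule: infinite_finite_induct) (auto intro: zero_closed add_closed)

lemma cring_alg: "cring alg"
  by (rule cring_of_type_class) (auto intro: zero_closed one_closed add_closed mult_closed uminus_closed)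

lemma finsum_alg:
  assumes "\<And>a. a \<in> A \<Longrightarrow> f a \<in> C"
  shows "finsum alg f A = sum f A"
proof -
  interpret cring alg by (rule cring_alg)
  show ?thesis
  proof (cases "finite A")
    case True
    then show ?thesis using assms
      by (induction A) (simp_all add: finsum_insert Pi_def)
  next
    case False
    then show ?thesis by (simp add: finsum_infinite)
  qed
qed

lemma component_in_homogeneous: "f \<in> C \<Longrightarrow> component i f \<in> homogeneous i"
  by (auto simp: component_def homogeneous_def component_closed keys_restrict_keys)

lemma component_sum: "component i (sum f A) = (\<Sum>a\<in>A. component i (f a))"
  by (simp add: component_def restrict_keys_sum)

lemma component_homogeneous: "f \<in> homogeneous j \<Longrightarrow> component i f = (if i = j then f else 0)"
proof -
  assume f: "f \<in> homogeneous j"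
  show ?thesis
  proof (cases "i = j")
    case True
    then show ?thesis using f by (simp add: component_def homogeneous_def restrict_keys_id subset_iff)
  next
    case False
    then show ?thesis using f
      by (intro poly_mapping_eqI) (auto simp: component_def homogeneous_def lookup_restrict_keys in_keys_iff)
  qed
qed

lemma component_Suc_linear_times:
  assumes "f \<in> homogeneous 1"
  shows "component (Suc i) (f * g) = f * component i g"
  unfolding component_def
  using restrict_keys_times_gen[of f g "{m. \<delta> m = Suc i}" UNIV "{m. \<delta> m = i}"] assms
  by (simp add: homogeneous_def delta_add restrict_keys_id)

lemma component_0_linear_times:
  assumes "f \<in> homogeneous 1"
  shows "component 0 (f * g) = 0"
  unfolding component_def
  using restrict_keys_times_gen[of f g "{m. \<delta> m = 0}" "{}" UNIV] assms
  by (simp add: homogeneous_def delta_add restrict_keys_id)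

lemma sum_components: "finite I \<Longrightarrow> \<delta> ` keys f \<subseteq> I \<Longrightarrow> (\<Sum>i\<in>I. component i f) = f"
proof (rule poly_mapping_eqI)
  fix m assume I: "finite I" "\<delta> ` keys f \<subseteq> I"
  have "lookup (\<Sum>i\<in>I. component i f) m = (\<Sum>i\<in>I. if i = \<delta> m then lookup f m else 0)"
    unfolding lookup_sum component_def by (intro sum.cong) (auto simp: lookup_restrict_keys)
  moreover have "lookup f m = 0" if "\<delta> m \<notin> I"
    using that I by (meson imageI in_keys_iff subsetD)
  ultimately show "lookup (\<Sum>i\<in>I. component i f) m = lookup f m"
    using I(1) by auto
qed

lemma homogeneous_subset: "homogeneous i \<subseteq> C"
  by (auto simp: homogeneous_def)

lemma homogeneous_closed:
  "0 \<in> homogeneous i"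
  "f \<in> homogeneous i \<Longrightarrow> g \<in> homogeneous i \<Longrightarrow> f + g \<in> homogeneous i"
  "f \<in> homogeneous i \<Longrightarrow> g \<in> homogeneous j \<Longrightarrow> f * g \<in> homogeneous (i + j)"
proof -
  show "f + g \<in> homogeneous i" if "f \<in> homogeneous i" "g \<in> homogeneous i"
    using that keys_add[of f g] by (auto simp: homogeneous_def add_closed)
  show "f * g \<in> homogeneous (i + j)" if "f \<in> homogeneous i" "g \<in> homogeneous j"
    using that keys_mult[of f g] by (auto simp: homogeneous_def mult_closed delta_add subset_iff)
qed (simp add: homogeneous_def zero_closed)

lemma delta_0: "\<delta> 0 = 0"
  using delta_add[of 0 0] by simp

lemma homogeneous_0: "homogeneous 0 = {single 0 c |c. True}"
  using degree_0 const_closed delta_0 by (auto simp: homogeneous_def split: if_splits)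

lemma homogeneous_smult: "f \<in> homogeneous i \<Longrightarrow> single 0 c * f \<in> homogeneous i"
  using homogeneous_closed(3)[of "single 0 c" 0 f i] homogeneous_0 by auto

lemma homogeneous_sum: "(\<And>a. a \<in> A \<Longrightarrow> f a \<in> homogeneous i) \<Longrightarrow> sum f A \<in> homogeneous i"
  by (induction A rule: infinite_finite_induct) (auto intro: homogeneous_closed)

lemma a_inv_alg: "f \<in> C \<Longrightarrow> a_inv alg f = - f"
  using cring.sum_zero_eq_neg[OF cring_alg, of "- f" f] by (simp add: uminus_closed)

lemma irrelevant_ideal_alg: "irrelevant_ideal alg = {f \<in> C. component 0 f = 0}"
proof
  interpret cring alg by (rule cring_alg)
  have "ideal {f \<in> C. component 0 f = 0} alg"
  proof (rule idealI)
    show "subgroup {f \<in> C. component 0 f = 0} (add_monoid alg)"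
    proof (rule add.subgroupI)
      fix f assume f: "f \<in> {f \<in> C. component 0 f = 0}"
      have "component 0 (- f) + component 0 f = 0"
        by (simp add: component_def flip: restrict_keys_add)
      then show "\<ominus>\<^bsub>alg\<^esub> f \<in> {f \<in> C. component 0 f = 0}"
        using f by (simp add: uminus_closed a_inv_alg)
    qed (auto simp: component_def add_closed restrict_keys_add intro!: exI[of _ 0] const_closed[of 0, simplified])
    have "component 0 (f * g) = component 0 f * component 0 g" for f g
      unfolding component_def by (rule restrict_keys_times) (simp add: delta_add)
    then show "f \<otimes>\<^bsub>alg\<^esub> g \<in> {f \<in> C. component 0 f = 0}" "g \<otimes>\<^bsub>alg\<^esub> f \<in> {f \<in> C. component 0 f = 0}"
      if "g \<in> {f \<in> C. component 0 f = 0}" "f \<in> carrier alg" for f g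
      using that by (simp_all add: mult_closed)
  qed (rule ring_axioms)
  moreover have "homog alg i \<subseteq> {f \<in> C. component 0 f = 0}" if "i \<ge> 1" for i
    using that component_homogeneous[of _ i 0] by (auto simp: homogeneous_def)
  ultimately show "irrelevant_ideal alg \<subseteq> {f \<in> C. component 0 f = 0}"
    unfolding irrelevant_ideal_def by (intro genideal_minimal) auto
  show "{f \<in> C. component 0 f = 0} \<subseteq> irrelevant_ideal alg"
  proof
    fix f assume f: "f \<in> {f \<in> C. component 0 f = 0}"
    have "ideal (irrelevant_ideal alg) alg"
      unfolding irrelevant_ideal_def by (intro genideal_ideal) auto
    then interpret I: ideal "irrelevant_ideal alg" alg .
    have sum_closed: "sum g A \<in> irrelevant_ideal alg" if "\<And>a. a \<in> A \<Longrightarrow> g a \<in> irrelevant_ideal alg"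
      for g :: "nat \<Rightarrow> _" and A
      using that I.zero_closed I.a_closed
      by (induction A rule: infinite_finite_induct) auto
    have "component i f \<in> irrelevant_ideal alg" for i
    proof (cases "i = 0")
      case True
      then show ?thesis using f I.zero_closed by simp
    next
      case False
      have "component i f \<in> homog alg i"
        using component_in_homogeneous f by (auto simp: homogeneous_def)
      moreover have "(\<Union>i\<in>{1..}. homog alg i) \<subseteq> irrelevant_ideal alg"
        unfolding irrelevant_ideal_def by (rule genideal_self) auto
      moreover have "i \<in> {1..}" using False by simp
      ultimately show ?thesis by blast
    qed
    then have "(\<Sum>i\<in>\<delta> ` keys f. component i f) \<in> irrelevant_ideal alg" by (rule sum_closed)
    then show "f \<in> irrelevant_ideal alg" by (simp add: sum_components)
  qed
qed

definition entries_in :: "('m \<Rightarrow>\<^sub>0 'k) set \<Rightarrow> (nat \<Rightarrow> nat \<Rightarrow> 'm \<Rightarrow>\<^sub>0 'k) \<Rightarrow> bool" where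
  "entries_in E M \<longleftrightarrow> (\<forall>j k. M j k \<in> E)"

lemma entries_in_mat_mult: "entries_in C M \<Longrightarrow> entries_in C N \<Longrightarrow> entries_in C (mat_mult b M N)"
  by (simp add: entries_in_def mat_mult_def sum_closed mult_closed)

end

context graded_subalgebra
begin

text \<open>A linear resolution of the residue field, given by its matrices alone. Exactness is stated for matrices
of columns instead of single vectors, as it is applied to the products of matrices. Entries of the
matrices of the resolution are 0 outside their sizes.\<close>

definition linear_resolution :: "(nat \<Rightarrow> nat) \<Rightarrow> (nat \<Rightarrow> nat \<Rightarrow> nat \<Rightarrow> 'm \<Rightarrow>\<^sub>0 'k) \<Rightarrow> bool" where
  "linear_resolution b D \<longleftrightarrow> b 0 = 1 \<and>
     (\<forall>i. supported (b i) (b (Suc i)) (D i) \<and> entries_in (homogeneous 1) (D i)) \<and>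
     (\<forall>i. mat_mult (b (Suc i)) (D i) (D (Suc i)) = (\<lambda>j l. 0)) \<and>
     (\<forall>N. entries_in C N \<and> (\<forall>k l. 1 \<le> k \<longrightarrow> N k l = 0) \<and> (\<forall>l. component 0 (N 0 l) = 0) \<longrightarrow>
        (\<exists>W. entries_in C W \<and> mat_mult (b 1) (D 0) W = N)) \<and>
     (\<forall>i N. entries_in C N \<and> (\<forall>k l. b (Suc i) \<le> k \<longrightarrow> N k l = 0) \<and>
        mat_mult (b (Suc i)) (D i) N = (\<lambda>j l. 0) \<longrightarrow>
        (\<exists>W. entries_in C W \<and> mat_mult (b (Suc (Suc i))) (D (Suc i)) W = N))"

text \<open>Vectors of the free modules are extensional functions. Each is the restriction of a function with all
values in \<open>C\<close>, and in terms of such functions the equality of an image and a kernel becomes a statement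
about sums.\<close>

lemma free_module_alg: "free_module alg r = {restrict w {..<r} |w. \<forall>k. w k \<in> C}"
proof
  show "free_module alg r \<subseteq> {restrict w {..<r} |w. \<forall>k. w k \<in> C}"
  proof
    fix v assume v: "v \<in> free_module alg r"
    then have "v = restrict (\<lambda>k. if k < r then v k else 0) {..<r}"
      by (auto simp: free_module_def PiE_def extensional_def restrict_def)
    moreover have "(if k < r then v k else 0) \<in> C" for k
      using v zero_closed by (auto simp: free_module_def)
    ultimately show "v \<in> {restrict w {..<r} |w. \<forall>k. w k \<in> C}" by blast
  qed
qed (auto simp: free_module_def split: if_splits)

lemma mat_apply_restrict:
  assumes "\<And>j k. j < r \<Longrightarrow> k < s \<Longrightarrow> M j k \<in> C" "\<And>k. w k \<in> C"
  shows "mat_apply alg r s M (restrict w {..<s}) = restrict (\<lambda>j. \<Sum>k<s. M j k * w k) {..<r}"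
  unfolding mat_apply_def
proof (rule restrict_ext)
  fix j assume "j \<in> {..<r}"
  then have "finsum alg (\<lambda>k. M j k \<otimes>\<^bsub>alg\<^esub> restrict w {..<s} k) {..<s} =
      (\<Sum>k<s. M j k \<otimes>\<^bsub>alg\<^esub> restrict w {..<s} k)"
    using assms by (intro finsum_alg) (auto intro: mult_closed)
  then show "finsum alg (\<lambda>k. M j k \<otimes>\<^bsub>alg\<^esub> restrict w {..<s} k) {..<s} = (\<Sum>k<s. M j k * w k)"
    by simp
qed

lemma restrict_eq_iff: "restrict f {..<r} = restrict g {..<r} \<longleftrightarrow> (\<forall>k<r. f k = g k)"
  for f g :: "nat \<Rightarrow> 'b"
  by (auto simp: restrict_def fun_eq_iff)

lemma mat_apply_image:
  assumes "\<And>j k. j < r \<Longrightarrow> k < s \<Longrightarrow> M j k \<in> C"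
  shows "restrict w {..<r} \<in> mat_apply alg r s M ` free_module alg s \<longleftrightarrow>
    (\<exists>w'. (\<forall>l. w' l \<in> C) \<and> (\<forall>k<r. w k = (\<Sum>l<s. M k l * w' l)))"
proof -
  have "mat_apply alg r s M ` free_module alg s =
      (\<lambda>w'. mat_apply alg r s M (restrict w' {..<s})) ` {w'. \<forall>k. w' k \<in> C}"
    unfolding free_module_alg by auto
  also have "\<dots> = (\<lambda>w'. restrict (\<lambda>j. \<Sum>k<s. M j k * w' k) {..<r}) ` {w'. \<forall>k. w' k \<in> C}"
    by (intro image_cong mat_apply_restrict assms) auto
  finally show ?thesis by (auto simp: restrict_eq_iff)
qed

lemma mat_apply_in_free_module:
  assumes "\<And>j k. j < r \<Longrightarrow> k < s \<Longrightarrow> M j k \<in> C"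
  shows "mat_apply alg r s M ` free_module alg s \<subseteq> free_module alg r"
proof -
  have "restrict (\<lambda>j. \<Sum>k<s. M j k * w k) {..<r} \<in> free_module alg r" if "\<And>k. w k \<in> C" for w
    using assms that by (auto simp: free_module_def intro!: sum_closed mult_closed)
  then show ?thesis
    unfolding free_module_alg[of s] using mat_apply_restrict[where M = M and r = r and s = s, OF assms]
    by auto
qed

lemma free_module_subset_eq_iff:
  assumes "A \<subseteq> free_module alg r" "B \<subseteq> free_module alg r"
  shows "A = B \<longleftrightarrow> (\<forall>w. (\<forall>k. w k \<in> C) \<longrightarrow> (restrict w {..<r} \<in> A \<longleftrightarrow> restrict w {..<r} \<in> B))"
proof
  assume eq: "\<forall>w. (\<forall>k. w k \<in> C) \<longrightarrow> (restrict w {..<r} \<in> A \<longleftrightarrow> restrict w {..<r} \<in> B)"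
  have "v \<in> A \<longleftrightarrow> v \<in> B" if "v \<in> free_module alg r" for v
    using that eq unfolding free_module_alg by blast
  then show "A = B" using assms by blast
qed auto

lemma exact_iff:
  assumes M: "\<And>j k. j < r \<Longrightarrow> k < s \<Longrightarrow> M j k \<in> C" and M': "\<And>k l. k < s \<Longrightarrow> l < t \<Longrightarrow> M' k l \<in> C"
  shows "mat_apply alg s t M' ` free_module alg t =
      {v \<in> free_module alg s. mat_apply alg r s M v = (\<lambda>j\<in>{..<r}. \<zero>\<^bsub>alg\<^esub>)} \<longleftrightarrow>
    (\<forall>w. (\<forall>k. w k \<in> C) \<longrightarrow> ((\<exists>w'. (\<forall>l. w' l \<in> C) \<and> (\<forall>k<s. w k = (\<Sum>l<t. M' k l * w' l))) \<longleftrightarrow>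
       (\<forall>j<r. (\<Sum>k<s. M j k * w k) = 0)))"
proof -
  have "restrict w {..<s} \<in> {v \<in> free_module alg s. mat_apply alg r s M v = (\<lambda>j\<in>{..<r}. \<zero>\<^bsub>alg\<^esub>)} \<longleftrightarrow>
      (\<forall>j<r. (\<Sum>k<s. M j k * w k) = 0)" if "\<forall>k. w k \<in> C" for w
  proof -
    have "restrict w {..<s} \<in> free_module alg s" using that by (auto simp: free_module_alg)
    then show ?thesis
      using that mat_apply_restrict[where M = M and w = w and r = r and s = s, OF M]
        restrict_eq_iff[of _ r "\<lambda>_. 0"] by simp
  qed
  then show ?thesis
    using mat_apply_image[OF M'] mat_apply_in_free_module[OF M']
    by (subst free_module_subset_eq_iff[of _ s]) auto
qed

lemma augmentation_iff:
  assumes M: "\<And>l. l < t \<Longrightarrow> M 0 l \<in> C"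
  shows "mat_apply alg 1 t M ` free_module alg t = {v \<in> free_module alg 1. v 0 \<in> irrelevant_ideal alg} \<longleftrightarrow>
    (\<forall>f\<in>C. (\<exists>w'. (\<forall>l. w' l \<in> C) \<and> f = (\<Sum>l<t. M 0 l * w' l)) \<longleftrightarrow> component 0 f = 0)"
proof -
  have M': "M j k \<in> C" if "j < 1" "k < t" for j k using M that by simp
  have "(\<forall>w. (\<forall>k. w k \<in> C) \<longrightarrow> Q (w (0::nat))) \<longleftrightarrow> (\<forall>f\<in>C. Q f)" for Q :: "_ \<Rightarrow> bool"
    using spec[where P = "\<lambda>w. (\<forall>k. w k \<in> C) \<longrightarrow> Q (w (0::nat))" and x = "\<lambda>_. _"] by auto
  moreover have "restrict w {..<1} \<in> {v \<in> free_module alg 1. v 0 \<in> irrelevant_ideal alg} \<longleftrightarrow>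
      component 0 (w 0) = 0" if "\<forall>k. w k \<in> C" for w
    using that by (auto simp: free_module_alg irrelevant_ideal_alg)
  moreover have "restrict w {..<1} \<in> mat_apply alg 1 t M ` free_module alg t \<longleftrightarrow>
      (\<exists>w'. (\<forall>l. w' l \<in> C) \<and> w 0 = (\<Sum>l<t. M 0 l * w' l))" for w
    using mat_apply_image[where M = M and r = 1 and s = t, OF M'] by simp
  moreover have "mat_apply alg 1 t M ` free_module alg t = {v \<in> free_module alg 1. v 0 \<in> irrelevant_ideal alg} \<longleftrightarrow>
      (\<forall>w. (\<forall>k. w k \<in> C) \<longrightarrow> (restrict w {..<1} \<in> mat_apply alg 1 t M ` free_module alg t \<longleftrightarrow>
        restrict w {..<1} \<in> {v \<in> free_module alg 1. v 0 \<in> irrelevant_ideal alg}))"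
    by (rule free_module_subset_eq_iff)
       (use mat_apply_in_free_module[where M = M and r = 1 and s = t, OF M'] in auto)
  ultimately show ?thesis by (simp del: One_nat_def)
qed

lemma mat_mult_solve_columns:
  assumes "\<And>w. (\<And>k. w k \<in> C) \<Longrightarrow> Q w \<Longrightarrow> \<exists>w'. (\<forall>l. w' l \<in> C) \<and> (\<forall>k<s. w k = (\<Sum>l<t. M k l * w' l))"
    and "entries_in C N" "\<And>l. Q (\<lambda>k. N k l)" "\<And>k l. s \<le> k \<Longrightarrow> N k l = 0" "\<And>k l. s \<le> k \<Longrightarrow> M k l = 0"
  shows "\<exists>W. entries_in C W \<and> mat_mult t M W = N"
proof -
  have "\<forall>l. \<exists>w'. (\<forall>i. w' i \<in> C) \<and> (\<forall>k<s. N k l = (\<Sum>i<t. M k i * w' i))"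
    using assms(1)[of "\<lambda>k. N k _"] assms(2,3) by (auto simp: entries_in_def)
  then obtain W where W: "\<And>l. (\<forall>i. W l i \<in> C) \<and> (\<forall>k<s. N k l = (\<Sum>i<t. M k i * W l i))" by metis
  have "mat_mult t M (\<lambda>i l. W l i) k l = N k l" for k l
    using W assms(4,5) by (cases "k < s") (auto simp: mat_mult_def)
  then show ?thesis using W by (intro exI[of _ "\<lambda>i l. W l i"]) (auto simp: entries_in_def)
qed

lemma linear_resolution_imp_koszul:
  assumes "linear_resolution b D"
  shows "koszul alg"
proof -
  have b0: "b 0 = 1" and supp: "\<And>i. supported (b i) (b (Suc i)) (D i)"
    and lin: "\<And>i. entries_in (homogeneous 1) (D i)"
    and complex: "\<And>i. mat_mult (b (Suc i)) (D i) (D (Suc i)) = (\<lambda>j l. 0)"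
    and aug: "\<And>N. entries_in C N \<Longrightarrow> (\<And>k l. 1 \<le> k \<Longrightarrow> N k l = 0) \<Longrightarrow> (\<And>l. component 0 (N 0 l) = 0) \<Longrightarrow>
        \<exists>W. entries_in C W \<and> mat_mult (b 1) (D 0) W = N"
    and exact: "\<And>i N. entries_in C N \<Longrightarrow> (\<And>k l. b (Suc i) \<le> k \<Longrightarrow> N k l = 0) \<Longrightarrow>
        mat_mult (b (Suc i)) (D i) N = (\<lambda>j l. 0) \<Longrightarrow>
        \<exists>W. entries_in C W \<and> mat_mult (b (Suc (Suc i))) (D (Suc i)) W = N"
    using assms unfolding linear_resolution_def by blast+
  have D_lin: "D i j k \<in> homogeneous 1" for i j k using lin by (simp add: entries_in_def)
  then have D_C: "D i j k \<in> C" for i j k using homogeneous_subset by blast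
  have "residue_field_resolution alg b (\<lambda>i j. int i) D"
    unfolding residue_field_resolution_def
  proof (intro conjI allI impI)
    show "D i j k \<in> homog_int alg (int (i + 1) - int i)" for i j k
      using D_lin[of i j k] by (simp add: homog_int_def homogeneous_def)
    show "mat_apply alg (b 0) (b 1) (D 0) ` free_module alg (b 1) =
        {v \<in> free_module alg (b 0). v 0 \<in> irrelevant_ideal alg}"
      unfolding b0 augmentation_iff[of "b 1" "D 0", OF D_C]
    proof (intro ballI iffI)
      fix f assume "f \<in> C" "component 0 f = 0"
      then have "\<exists>W. entries_in C W \<and> mat_mult (b 1) (D 0) W = (\<lambda>k l. if k = 0 then f else 0)"
        using zero_closed by (intro aug) (auto simp: entries_in_def)
      then obtain W where W: "entries_in C W"
        "mat_mult (b 1) (D 0) W = (\<lambda>k l. if k = 0 then f else 0)" by blast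
      from fun_cong[OF fun_cong[OF W(2)], of 0 0]
      show "\<exists>w'. (\<forall>l. w' l \<in> C) \<and> f = (\<Sum>l<b 1. D 0 0 l * w' l)"
        using W(1) by (intro exI[of _ "\<lambda>l. W l 0"]) (simp add: mat_mult_def entries_in_def)
    next
      fix f assume "\<exists>w'. (\<forall>l. w' l \<in> C) \<and> f = (\<Sum>l<b 1. D 0 0 l * w' l)"
      then show "component 0 f = 0"
        using component_0_linear_times[OF D_lin] by (auto simp: component_sum)
    qed
    show "mat_apply alg (b (i + 1)) (b (i + 2)) (D (i + 1)) ` free_module alg (b (i + 2)) =
        {v \<in> free_module alg (b (i + 1)).
          mat_apply alg (b i) (b (i + 1)) (D i) v = (\<lambda>j\<in>{..<b i}. \<zero>\<^bsub>alg\<^esub>)}" for i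
      unfolding exact_iff[of "b i" "b (i + 1)" "D i" "b (i + 2)" "D (i + 1)", OF D_C D_C]
    proof (intro allI impI iffI)
      fix w :: "nat \<Rightarrow> 'm \<Rightarrow>\<^sub>0 'k"
      assume w: "\<forall>k. w k \<in> C" and zero: "\<forall>j<b i. (\<Sum>k<b (i + 1). D i j k * w k) = 0"
      define N where "N = (\<lambda>k (l::nat). if k < b (i + 1) then w k else 0)"
      have "(\<Sum>k<b (i + 1). D i j k * N k l) = 0" for j l
        using zero supp[of i] by (cases "j < b i") (auto simp: N_def supported_def)
      then have "mat_mult (b (Suc i)) (D i) N = (\<lambda>j l. 0)" by (simp add: mat_mult_def)
      moreover have "entries_in C N" using w zero_closed by (simp add: N_def entries_in_def)
      ultimately obtain W where W: "entries_in C W" "mat_mult (b (Suc (Suc i))) (D (Suc i)) W = N"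
        using exact[of N i] by (auto simp: N_def)
      have "w k = (\<Sum>l<b (i + 2). D (i + 1) k l * W l 0)" if "k < b (i + 1)" for k
        using fun_cong[OF fun_cong[OF W(2)], of k 0] that by (simp add: mat_mult_def N_def)
      then show "\<exists>w'. (\<forall>l. w' l \<in> C) \<and> (\<forall>k<b (i + 1). w k = (\<Sum>l<b (i + 2). D (i + 1) k l * w' l))"
        using W(1) by (intro exI[of _ "\<lambda>l. W l 0"]) (simp add: entries_in_def)
    next
      fix w :: "nat \<Rightarrow> 'm \<Rightarrow>\<^sub>0 'k" and j
      assume "\<exists>w'. (\<forall>l. w' l \<in> C) \<and> (\<forall>k<b (i + 1). w k = (\<Sum>l<b (i + 2). D (i + 1) k l * w' l))"
      then obtain w' where w': "\<And>k. k < b (i + 1) \<Longrightarrow> w k = (\<Sum>l<b (i + 2). D (i + 1) k l * w' l)" by blast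
      have "mat_mult (b (i + 1)) (D i) (mat_mult (b (i + 2)) (D (i + 1)) (\<lambda>l _. w' l)) j 0 = 0"
        using complex[of i] by (simp flip: mat_mult_assoc) (simp add: mat_mult_def)
      then show "(\<Sum>k<b (i + 1). D i j k * w k) = 0"
        using w' by (simp add: mat_mult_def)
    qed
  qed (use b0 in auto)
  then show ?thesis unfolding koszul_def by (intro exI[of _ b] exI conjI) auto
qed

text \<open>Setting the entries outside the sizes of the matrices to 0 does not change the maps.\<close>

lemma koszul_imp_linear_resolution:
  assumes "koszul alg"
  obtains b D where "linear_resolution b D"
proof -
  obtain b d D where res: "residue_field_resolution alg b d D" and d: "\<And>i j. j < b i \<Longrightarrow> d i j = int i"
    using assms unfolding koszul_def by blast
  define D' where "D' i j k = (if j < b i \<and> k < b (Suc i) then D i j k else 0)" for i j k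
  have b0: "b 0 = 1" using res by (simp add: residue_field_resolution_def)
  have D_lin: "D i j k \<in> homogeneous 1" if "j < b i" "k < b (i + 1)" for i j k
  proof -
    have "D i j k \<in> homog_int alg (d (i + 1) k - d i j)"
      using res that by (simp add: residue_field_resolution_def)
    then show ?thesis using d that by (simp add: homog_int_def homogeneous_def)
  qed
  then have D_C: "D i j k \<in> C" if "j < b i" "k < b (i + 1)" for i j k
    using that homogeneous_subset by blast
  have D'_lin: "entries_in (homogeneous 1) (D' i)" for i
    using D_lin homogeneous_closed(1) by (auto simp: entries_in_def D'_def)
  have aug: "(\<exists>w'. (\<forall>l. w' l \<in> C) \<and> f = (\<Sum>l<b 1. D 0 0 l * w' l)) \<longleftrightarrow> component 0 f = 0" if "f \<in> C" for f
  proof -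
    have "mat_apply alg 1 (b 1) (D 0) ` free_module alg (b 1) = {v \<in> free_module alg 1. v 0 \<in> irrelevant_ideal alg}"
      using res b0 by (simp add: residue_field_resolution_def)
    then show ?thesis using that b0 D_C[of 0 0] by (subst (asm) augmentation_iff) auto
  qed
  have exact: "(\<exists>w'. (\<forall>l. w' l \<in> C) \<and> (\<forall>k<b (i + 1). w k = (\<Sum>l<b (i + 2). D (i + 1) k l * w' l))) \<longleftrightarrow>
       (\<forall>j<b i. (\<Sum>k<b (i + 1). D i j k * w k) = 0)" if "\<And>k. w k \<in> C" for i w
  proof -
    have "mat_apply alg (b (i + 1)) (b (i + 2)) (D (i + 1)) ` free_module alg (b (i + 2)) =
        {v \<in> free_module alg (b (i + 1)).
          mat_apply alg (b i) (b (i + 1)) (D i) v = (\<lambda>j\<in>{..<b i}. \<zero>\<^bsub>alg\<^esub>)}"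
      using res unfolding residue_field_resolution_def by blast
    moreover have "D (i + 1) k l \<in> C" if "k < b (i + 1)" "l < b (i + 2)" for k l
      using D_C[of k "i + 1" l] that by simp
    ultimately show ?thesis
      using that D_C[of _ i] by (subst (asm) exact_iff) auto
  qed
  have "linear_resolution b D'"
    unfolding linear_resolution_def
  proof (intro conjI allI impI)
    show "mat_mult (b (Suc i)) (D' i) (D' (Suc i)) = (\<lambda>j l. 0)" for i
    proof (intro ext)
      fix j l
      show "mat_mult (b (Suc i)) (D' i) (D' (Suc i)) j l = 0"
      proof (cases "j < b i \<and> l < b (Suc (Suc i))")
        case True
        have "\<exists>w'. (\<forall>l. w' l \<in> C) \<and> (\<forall>k<b (i + 1). D' (Suc i) k l = (\<Sum>l<b (i + 2). D (i + 1) k l * w' l))"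
          using True zero_closed one_closed
          by (intro exI[of _ "\<lambda>m. if m = l then 1 else 0"])
             (auto simp: D'_def if_distrib[of "\<lambda>y. _ * y"] cong: if_cong)
        moreover have "D' (Suc i) k l \<in> C" for k
          using D'_lin homogeneous_subset by (force simp: entries_in_def)
        ultimately have "(\<Sum>k<b (i + 1). D i j k * D' (Suc i) k l) = 0"
          using exact[of "\<lambda>k. D' (Suc i) k l" i] True by simp
        then show ?thesis using True by (simp add: mat_mult_def D'_def)
      qed (auto simp: mat_mult_def D'_def)
    qed
  next
    fix N assume N: "entries_in C N \<and> (\<forall>k l. 1 \<le> k \<longrightarrow> N k l = 0) \<and> (\<forall>l. component 0 (N 0 l) = 0)"
    show "\<exists>W. entries_in C W \<and> mat_mult (b 1) (D' 0) W = N"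
    proof (rule mat_mult_solve_columns[where Q = "\<lambda>w. component 0 (w 0) = 0" and s = 1])
      fix w :: "nat \<Rightarrow> 'm \<Rightarrow>\<^sub>0 'k" assume "\<And>k. w k \<in> C" "component 0 (w 0) = 0"
      then show "\<exists>w'. (\<forall>l. w' l \<in> C) \<and> (\<forall>k<1. w k = (\<Sum>l<b 1. D' 0 k l * w' l))"
        using aug[of "w 0"] b0 by (auto simp: D'_def)
    qed (use N b0 in \<open>auto simp: D'_def\<close>)
  next
    fix i N assume N: "entries_in C N \<and> (\<forall>k l. b (Suc i) \<le> k \<longrightarrow> N k l = 0) \<and>
      mat_mult (b (Suc i)) (D' i) N = (\<lambda>j l. 0)"
    show "\<exists>W. entries_in C W \<and> mat_mult (b (Suc (Suc i))) (D' (Suc i)) W = N"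
    proof (rule mat_mult_solve_columns[where
          Q = "\<lambda>w. \<forall>j<b i. (\<Sum>k<b (i + 1). D i j k * w k) = 0" and s = "b (Suc i)"])
      fix w :: "nat \<Rightarrow> 'm \<Rightarrow>\<^sub>0 'k" assume "\<And>k. w k \<in> C" "\<forall>j<b i. (\<Sum>k<b (i + 1). D i j k * w k) = 0"
      then show "\<exists>w'. (\<forall>l. w' l \<in> C) \<and> (\<forall>k<b (Suc i). w k = (\<Sum>l<b (Suc (Suc i)). D' (Suc i) k l * w' l))"
        using exact[of w i] by (simp add: D'_def)
    next
      fix l
      have "(\<Sum>k<b (i + 1). D i j k * N k l) = mat_mult (b (Suc i)) (D' i) N j l" if "j < b i" for j
        unfolding mat_mult_def using that by (intro sum.cong) (auto simp: D'_def)
      then show "\<forall>j<b i. (\<Sum>k<b (i + 1). D i j k * N k l) = 0"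
        using N by simp
    qed (use N in \<open>auto simp: D'_def\<close>)
  qed (use b0 D'_lin in \<open>auto simp: supported_def D'_def\<close>)
  then show ?thesis by (rule that)
qed

end

section \<open>The Koszul property passes to graded retracts\<close>

text \<open>The map \<open>\<rho>\<close> is a graded retraction of the algebra with carrier \<open>C\<close> onto the subalgebra with carrier
\<open>C'\<close>. It fixes the constants, which belong to both.\<close>

locale graded_retract = A: graded_subalgebra \<delta> C + R: graded_subalgebra \<delta> C'
  for \<delta> :: "'m::comm_monoid_add \<Rightarrow> nat" and C C' :: "('m \<Rightarrow>\<^sub>0 'k::field) set" +
  fixes \<rho> :: "('m \<Rightarrow>\<^sub>0 'k) \<Rightarrow> ('m \<Rightarrow>\<^sub>0 'k)"
  assumes retract_subset: "C' \<subseteq> C"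
    and retract_id: "f \<in> C' \<Longrightarrow> \<rho> f = f"
    and retract_add: "f \<in> C \<Longrightarrow> g \<in> C \<Longrightarrow> \<rho> (f + g) = \<rho> f + \<rho> g"
    and retract_times: "f \<in> C \<Longrightarrow> g \<in> C \<Longrightarrow> \<rho> (f * g) = \<rho> f * \<rho> g"
    and retract_homogeneous: "f \<in> A.homogeneous i \<Longrightarrow> \<rho> f \<in> R.homogeneous i"
    and retract_closed: "f \<in> C \<Longrightarrow> \<rho> f \<in> C'"
begin

definition retract_mat :: "(nat \<Rightarrow> nat \<Rightarrow> 'm \<Rightarrow>\<^sub>0 'k) \<Rightarrow> nat \<Rightarrow> nat \<Rightarrow> 'm \<Rightarrow>\<^sub>0 'k" where
  "retract_mat M = (\<lambda>j k. \<rho> (M j k))"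

lemma retract_sum: "(\<And>a. a \<in> I \<Longrightarrow> f a \<in> C) \<Longrightarrow> \<rho> (sum f I) = (\<Sum>a\<in>I. \<rho> (f a))"
  by (induction I rule: infinite_finite_induct)
     (auto simp: retract_add A.sum_closed retract_id[OF R.zero_closed])

lemma retract_mat_mult:
  "A.entries_in C M \<Longrightarrow> A.entries_in C N \<Longrightarrow>
    retract_mat (mat_mult b M N) = mat_mult b (retract_mat M) (retract_mat N)"
  by (simp add: retract_mat_def mat_mult_def A.entries_in_def retract_sum retract_times A.mult_closed)

lemma retract_mat_id: "A.entries_in C' M \<Longrightarrow> retract_mat M = M"
  by (simp add: retract_mat_def A.entries_in_def retract_id)

lemma entries_in_retract_mat: "A.entries_in C M \<Longrightarrow> A.entries_in C' (retract_mat M)"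
  by (simp add: retract_mat_def A.entries_in_def retract_closed)

lemma entries_in_subset: "A.entries_in E M \<Longrightarrow> E \<subseteq> E' \<Longrightarrow> A.entries_in E' M"
  by (auto simp: A.entries_in_def)

definition constant_mat :: "(nat \<Rightarrow> nat \<Rightarrow> 'm \<Rightarrow>\<^sub>0 'k) \<Rightarrow> bool" where
  "constant_mat M \<longleftrightarrow> A.entries_in (A.homogeneous 0) M"

lemma constant_in_C': "A.homogeneous 0 \<subseteq> C'"
  using R.const_closed A.homogeneous_0 by auto

lemma constant_mat_entries: "constant_mat M \<Longrightarrow> A.entries_in C M" "constant_mat M \<Longrightarrow> A.entries_in C' M"
  unfolding constant_mat_def using constant_in_C' A.homogeneous_subset by (auto intro: entries_in_subset)

lemma constant_mat_mult: "constant_mat M \<Longrightarrow> constant_mat N \<Longrightarrow> constant_mat (mat_mult b M N)"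
  unfolding constant_mat_def A.entries_in_def mat_mult_def
  using A.homogeneous_closed(3)[of _ 0 _ 0] by (auto intro!: A.homogeneous_sum)

lemma homogeneous_mat_mult:
  "A.entries_in (A.homogeneous i) M \<Longrightarrow> A.entries_in (A.homogeneous j) N \<Longrightarrow>
    A.entries_in (A.homogeneous (i + j)) (mat_mult b M N)"
  unfolding A.entries_in_def mat_mult_def by (auto intro!: A.homogeneous_sum A.homogeneous_closed)

lemma constant_idempotent_split:
  assumes "constant_mat P" "supported b b P" "mat_mult b P P = P"
  obtains c Q S where "constant_mat Q" "constant_mat S" "supported b c Q" "supported c b S"
    "mat_mult c Q S = P" "mat_mult b S Q = mat_one c"
proof -
  let ?const = "\<lambda>M j k. single 0 (M j k :: 'k) :: 'm \<Rightarrow>\<^sub>0 'k"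
  have const_mult: "?const (mat_mult n M N) = mat_mult n (?const M) (?const N)" for n M N
  proof -
    have "single 0 (sum f I) = (\<Sum>i\<in>I. single (0::'m) (f i :: 'k))" for f and I :: "nat set"
      by (induction I rule: infinite_finite_induct) (simp_all add: single_add)
    then show ?thesis by (simp add: mat_mult_def mult_single)
  qed
  have "\<forall>j k. \<exists>c. P j k = single 0 c"
    using assms(1) unfolding constant_mat_def A.entries_in_def A.homogeneous_0 by blast
  then obtain p where p: "P = ?const p" by (metis ext)
  have const_eqD: "M = N" if "?const M = ?const N" for M N :: "nat \<Rightarrow> nat \<Rightarrow> 'k"
    by (rule ext, rule ext, rule injD[OF inj_single], rule fun_cong[OF fun_cong[OF that]])
  have "single (0::'m) x = 0 \<Longrightarrow> x = 0" for x :: 'k by (metis lookup_single_eq lookup_zero)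
  then have supp: "supported b b p" using assms(2) by (simp add: p supported_def)
  have idem: "mat_mult b p p = p" using assms(3) by (intro const_eqD) (simp add: p const_mult)
  obtain c q s where q: "supported b c q" and s: "supported c b s" and qs: "mat_mult c q s = p"
    and sq: "mat_mult b s q = mat_one c"
    using idempotent_matrix_split[OF supp idem] by blast
  have "mat_mult b (?const s) (?const q) = mat_one c"
    unfolding const_mult[symmetric] sq by (auto simp: mat_one_def fun_eq_iff)
  moreover have "mat_mult c (?const q) (?const s) = P"
    unfolding const_mult[symmetric] qs p ..
  moreover have "constant_mat (?const M)" for M
    unfolding constant_mat_def A.entries_in_def A.homogeneous_0 by blast
  moreover have "supported b c (?const q)" "supported c b (?const s)"
    using q s by (simp_all add: supported_def)
  ultimately show ?thesis using that by blast
qed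

text \<open>A linear resolution is minimal: a constant column that the differential kills is a combination of
columns of the next matrix, hence of positive degree, hence zero.\<close>

lemma linear_mat_inj:
  assumes res: "A.linear_resolution b D"
    and const_YZ: "constant_mat Y" "constant_mat Z"
    and rows: "\<And>k l. b (Suc i) \<le> k \<Longrightarrow> Y k l = 0" "\<And>k l. b (Suc i) \<le> k \<Longrightarrow> Z k l = 0"
    and eq: "mat_mult (b (Suc i)) (D i) Y = mat_mult (b (Suc i)) (D i) Z"
  shows "Y = Z"
proof -
  define N where "N = (\<lambda>k l. Y k l + single 0 (-1) * Z k l)"
  have N: "N k l = Y k l - Z k l" for k l by (simp add: N_def single_uminus)
  have "N k l \<in> A.homogeneous 0" for k l
    using const_YZ unfolding N_def constant_mat_def A.entries_in_def
    by (intro A.homogeneous_closed A.homogeneous_smult) auto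
  then have N_0: "A.component 0 (N k l) = N k l" and "A.entries_in C N" for k l
    using A.homogeneous_subset by (auto simp: A.component_homogeneous[of _ 0] A.entries_in_def)
  moreover have "mat_mult (b (Suc i)) (D i) N = (\<lambda>j l. 0)"
    using eq by (simp add: mat_mult_def N right_diff_distrib sum_subtractf fun_eq_iff)
  moreover have "\<forall>k l. b (Suc i) \<le> k \<longrightarrow> N k l = 0" using rows by (simp add: N)
  ultimately obtain W where W: "mat_mult (b (Suc (Suc i))) (D (Suc i)) W = N"
    using res unfolding A.linear_resolution_def by blast
  have "D (Suc i) k l \<in> A.homogeneous 1" for k l
    using res by (simp add: A.linear_resolution_def A.entries_in_def)
  then have "A.component 0 (N k l) = 0" for k l
    unfolding W[symmetric] mat_mult_def by (simp add: A.component_sum A.component_0_linear_times)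
  then have "N k l = 0" for k l using N_0 by metis
  then show ?thesis by (simp add: N fun_eq_iff)
qed

text \<open>Any solution of a system of linear forms with linear coefficients can be replaced by its constant part.\<close>

lemma lift_linear_mat:
  assumes res: "A.linear_resolution b D"
    and W: "mat_mult (b (Suc i)) (D i) W = N" "A.entries_in C W"
    and N: "A.entries_in (A.homogeneous 1) N" "\<And>j l. c \<le> l \<Longrightarrow> N j l = 0"
  obtains P where "constant_mat P" "supported (b (Suc i)) c P" "mat_mult (b (Suc i)) (D i) P = N"
proof -
  define P where "P = (\<lambda>k l. if k < b (Suc i) \<and> l < c then A.component 0 (W k l) else 0)"
  have D: "D i k l \<in> A.homogeneous 1" for k l
    using res by (simp add: A.linear_resolution_def A.entries_in_def)
  have "mat_mult (b (Suc i)) (D i) P j l = N j l" for j l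
  proof (cases "l < c")
    case True
    have "mat_mult (b (Suc i)) (D i) P j l = (\<Sum>k<b (Suc i). A.component 1 (D i j k * W k l))"
      using A.component_Suc_linear_times[OF D] True by (simp add: mat_mult_def P_def)
    also have "\<dots> = A.component 1 (N j l)"
      unfolding W(1)[symmetric] by (simp add: mat_mult_def A.component_sum)
    also have "\<dots> = N j l" using N(1) by (simp add: A.component_homogeneous[of _ 1] A.entries_in_def)
    finally show ?thesis .
  next
    case False
    then show ?thesis using N(2)[of l j] by (simp add: mat_mult_def P_def)
  qed
  moreover have "constant_mat P"
    using W(2) A.component_in_homogeneous A.homogeneous_closed(1)
    by (simp add: constant_mat_def A.entries_in_def P_def)
  ultimately show ?thesis using that[of P] by (auto simp: P_def supported_def fun_eq_iff)
qed

text \<open>Let \<open>D i\<close> be the matrices of a linear resolution over \<open>A\<close> and \<open>E i = \<rho> (D i)\<close>. Since the resolution is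
exact, the ring endomorphism \<open>\<rho>\<close> of \<open>A\<close> lifts to a \<open>\<rho>\<close>-semilinear chain map of the resolution to
itself, which applies \<open>\<rho>\<close> to the entries of a vector and then a matrix \<open>P i\<close>. As all entries of
\<open>D i\<close> and \<open>E i\<close> are linear, the \<open>P i\<close> can be taken constant, and the chain map condition reads
\<open>P i * E i = D i * P (i + 1)\<close>. Minimality makes the lift unique, so \<open>P i\<close> inherits idempotency from
\<open>\<rho>\<close>. The image of the chain map is a complex of free modules over the retract. It is exact, because
a cycle in the image is the boundary of some vector and therefore also of the image of this vector.
With respect to bases given by a splitting \<open>P i = Q i * S i\<close>, \<open>S i * Q i = 1\<close>, its differentials are
the linear matrices \<open>S i * E i * Q (i + 1)\<close>.\<close>

lemma koszul_retract:
  assumes "koszul A.alg"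
  shows "koszul R.alg"
proof -
  obtain b D where res: "A.linear_resolution b D"
    using A.koszul_imp_linear_resolution[OF assms] by blast
  have b0: "b 0 = 1" and D_supp: "\<And>i. supported (b i) (b (Suc i)) (D i)"
    and D_lin: "\<And>i. A.entries_in (A.homogeneous 1) (D i)"
    and complex: "\<And>i. mat_mult (b (Suc i)) (D i) (D (Suc i)) = (\<lambda>j l. 0)"
    and aug: "\<And>N. A.entries_in C N \<Longrightarrow> (\<And>k l. 1 \<le> k \<Longrightarrow> N k l = 0) \<Longrightarrow> (\<And>l. A.component 0 (N 0 l) = 0) \<Longrightarrow>
        \<exists>W. A.entries_in C W \<and> mat_mult (b 1) (D 0) W = N"
    and exact: "\<And>i N. A.entries_in C N \<Longrightarrow> (\<And>k l. b (Suc i) \<le> k \<Longrightarrow> N k l = 0) \<Longrightarrow>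
        mat_mult (b (Suc i)) (D i) N = (\<lambda>j l. 0) \<Longrightarrow>
        \<exists>W. A.entries_in C W \<and> mat_mult (b (Suc (Suc i))) (D (Suc i)) W = N"
    using res unfolding A.linear_resolution_def by blast+
  have D_C: "A.entries_in C (D i)" for i
    using D_lin A.homogeneous_subset by (rule entries_in_subset)
  define E where "E i = retract_mat (D i)" for i
  have E_supp: "supported (b i) (b (Suc i)) (E i)" for i
    using D_supp[of i] retract_id[OF R.zero_closed] by (simp add: E_def supported_def retract_mat_def)
  have E_lin': "A.entries_in (R.homogeneous 1) (E i)" for i
    using D_lin[of i] retract_homogeneous by (simp add: E_def A.entries_in_def retract_mat_def)
  have E_lin: "A.entries_in (A.homogeneous 1) (E i)" for i
    using E_lin'[of i] retract_subset by (auto simp: A.entries_in_def A.homogeneous_def R.homogeneous_def)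
  have E_C': "A.entries_in C' (E i)" for i using E_lin' R.homogeneous_subset by (rule entries_in_subset)
  have E_C: "A.entries_in C (E i)" for i using E_lin A.homogeneous_subset by (rule entries_in_subset)
  have E_complex: "mat_mult (b (Suc i)) (E i) (E (Suc i)) = (\<lambda>j l. 0)" for i
    using arg_cong[OF complex[of i], of retract_mat] retract_id[OF R.zero_closed]
    by (simp add: retract_mat_mult D_C E_def) (simp add: retract_mat_def)

  (* The last condition says that the chain map can be extended by one more step. *)
  define good where "good i P \<longleftrightarrow> constant_mat P \<and> supported (b i) (b i) P \<and> mat_mult (b i) P P = P \<and>
      (i = 0 \<longrightarrow> P = mat_one 1) \<and>
      (\<exists>W. A.entries_in C W \<and> mat_mult (b (Suc i)) (D i) W = mat_mult (b i) P (E i))" for i P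
  have "1 \<in> A.homogeneous 0"
    unfolding A.homogeneous_0 by (intro CollectI exI[of _ 1]) simp
  then have one_const: "constant_mat (mat_one r)" for r
    using A.homogeneous_closed(1) by (simp add: constant_mat_def A.entries_in_def mat_one_def)
  have "\<exists>W. A.entries_in C W \<and> mat_mult (b 1) (D 0) W = E 0"
  proof (rule aug)
    show "E 0 k l = 0" if "1 \<le> k" for k l using E_supp[of 0] b0 that by (simp add: supported_def)
    show "A.component 0 (E 0 0 l) = 0" for l
      using E_lin[of 0] A.component_homogeneous[of _ 1 0] by (simp add: A.entries_in_def)
  qed (rule E_C)
  moreover have E_0: "mat_mult 1 (mat_one 1) (E 0) = E 0"
    using E_supp[of 0] b0 by (intro mat_one_left) (auto simp: supported_def)
  moreover have "mat_mult 1 (mat_one 1) (mat_one 1) = (mat_one 1 :: nat \<Rightarrow> nat \<Rightarrow> 'm \<Rightarrow>\<^sub>0 'k)"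
    by (rule mat_one_left) (simp add: mat_one_def)
  ultimately have good_0: "good 0 (mat_one 1)"
    unfolding good_def using b0 one_const supported_mat_one[of 1] by auto
  have step: "\<exists>P'. good (Suc i) P' \<and> mat_mult (b i) P (E i) = mat_mult (b (Suc i)) (D i) P'"
    if "good i P" for i P
  proof -
    have P: "constant_mat P" "supported (b i) (b i) P" "mat_mult (b i) P P = P"
      using that by (simp_all add: good_def)
    have "\<exists>W. A.entries_in C W \<and> mat_mult (b (Suc i)) (D i) W = mat_mult (b i) P (E i)"
      using that by (simp add: good_def)
    then obtain W where W: "A.entries_in C W" "mat_mult (b (Suc i)) (D i) W = mat_mult (b i) P (E i)" by blast
    have "A.entries_in (A.homogeneous 1) (mat_mult (b i) P (E i))"
      using homogeneous_mat_mult[of 0 P 1] P(1) E_lin by (simp add: constant_mat_def)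
    moreover have "mat_mult (b i) P (E i) j l = 0" if "b (Suc i) \<le> l" for j l
      using E_supp[of i] that by (simp add: mat_mult_def supported_def)
    ultimately obtain P' where P': "constant_mat P'" "supported (b (Suc i)) (b (Suc i)) P'"
      "mat_mult (b (Suc i)) (D i) P' = mat_mult (b i) P (E i)"
      using lift_linear_mat[OF res W(2,1)] by blast
    note C = D_C E_C constant_mat_entries(1)[OF P(1)] constant_mat_entries(1)[OF P'(1)]
    have ret: "retract_mat (mat_mult (b i) P (E i)) = mat_mult (b i) P (E i)"
      using P(1) C by (simp add: retract_mat_mult retract_mat_id E_C' constant_mat_entries)
    have "mat_mult (b (Suc i)) (D i) (mat_mult (b (Suc i)) P' P')
        = mat_mult (b (Suc i)) (mat_mult (b i) P (E i)) P'"
      by (simp add: P'(3) flip: mat_mult_assoc)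
    also have "\<dots> = mat_mult (b i) P (mat_mult (b (Suc i)) (E i) P')" by (rule mat_mult_assoc)
    also have "mat_mult (b (Suc i)) (E i) P' = retract_mat (mat_mult (b (Suc i)) (D i) P')"
      using P'(1) C by (simp add: E_def retract_mat_mult retract_mat_id constant_mat_entries)
    also have "\<dots> = mat_mult (b i) P (E i)" unfolding P'(3) ret ..
    also have "mat_mult (b i) P (mat_mult (b i) P (E i)) = mat_mult (b (Suc i)) (D i) P'"
      by (simp add: P(3) P'(3) flip: mat_mult_assoc)
    finally have eq: "mat_mult (b (Suc i)) (D i) (mat_mult (b (Suc i)) P' P') =
        mat_mult (b (Suc i)) (D i) P'" .
    (* Both sides are lifts of the same map, hence equal by minimality. *)
    have idem: "mat_mult (b (Suc i)) P' P' = P'"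
      by (rule linear_mat_inj[OF res constant_mat_mult[OF P'(1) P'(1)] P'(1) _ _ eq])
         (use P'(2) in \<open>simp_all add: supported_def mat_mult_def\<close>)
    let ?N = "mat_mult (b (Suc i)) P' (E (Suc i))"
    have "\<exists>W. A.entries_in C W \<and> mat_mult (b (Suc (Suc i))) (D (Suc i)) W = ?N"
    proof (rule exact)
      show "A.entries_in C ?N" using C by (intro A.entries_in_mat_mult)
      show "?N k l = 0" if "b (Suc i) \<le> k" for k l
        using P'(2) that by (simp add: mat_mult_def supported_def)
      have "mat_mult (b (Suc i)) (D i) ?N = mat_mult (b (Suc i)) (mat_mult (b i) P (E i)) (E (Suc i))"
        by (simp add: P'(3) flip: mat_mult_assoc)
      also have "\<dots> = (\<lambda>j l. 0)" by (simp add: mat_mult_assoc E_complex)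
      finally show "mat_mult (b (Suc i)) (D i) ?N = (\<lambda>j l. 0)" .
    qed
    then have "good (Suc i) P'" using P' idem by (simp add: good_def)
    then show ?thesis using P'(3) by (intro exI[of _ P']) simp
  qed
  obtain P where good: "\<And>i. good i (P i)"
    and chain: "\<And>i. mat_mult (b i) (P i) (E i) = mat_mult (b (Suc i)) (D i) (P (Suc i))"
    using dependent_nat_choice[of good "\<lambda>i P P'. mat_mult (b i) P (E i) = mat_mult (b (Suc i)) (D i) P'"]
      good_0 step by blast
  have P_const: "constant_mat (P i)" and P_supp: "supported (b i) (b i) (P i)"
    and P_idem: "mat_mult (b i) (P i) (P i) = P i" and P_0: "P 0 = mat_one 1" for i
    using good[of i] good[of 0] by (simp_all add: good_def)
  have chain': "mat_mult (b i) (P i) (E i) = mat_mult (b (Suc i)) (E i) (P (Suc i))" for i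
    using arg_cong[OF chain[of i], of retract_mat]
    by (simp add: retract_mat_mult D_C E_C P_const constant_mat_entries retract_mat_id E_C' flip: E_def)

  (* The splitting of P 0 is prescribed, because the resolution must start with the algebra itself. *)
  have "\<exists>c Q S. constant_mat Q \<and> constant_mat S \<and> supported (b i) c Q \<and> supported c (b i) S \<and>
      mat_mult c Q S = P i \<and> mat_mult (b i) S Q = mat_one c \<and> (i = 0 \<longrightarrow> c = 1 \<and> S = mat_one 1)" for i
  proof (cases "i = 0")
    case True
    then show ?thesis
      using one_const b0 P_0 P_idem[of 0]
      by (intro exI[of _ 1] exI[of _ "mat_one 1"]) (auto simp: supported_mat_one simp del: One_nat_def)
  next
    case False
    then show ?thesis
      using constant_idempotent_split[OF P_const[of i] P_supp[of i] P_idem[of i]] by metis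
  qed
  then obtain c Q S where Q: "\<And>i. constant_mat (Q i)" "\<And>i. supported (b i) (c i) (Q i)"
    and S: "\<And>i. constant_mat (S i)" "\<And>i. supported (c i) (b i) (S i)"
    and QS: "\<And>i. mat_mult (c i) (Q i) (S i) = P i" and SQ: "\<And>i. mat_mult (b i) (S i) (Q i) = mat_one (c i)"
    and c0: "c 0 = 1" and S0: "S 0 = mat_one 1"
    by metis
  define D' where "D' i = mat_mult (b i) (S i) (mat_mult (b (Suc i)) (E i) (Q (Suc i)))" for i
  note entries = constant_mat_entries[OF Q(1)] constant_mat_entries[OF S(1)] constant_mat_entries[OF P_const] E_C' E_C D_C
  have D'_QS: "mat_mult (c (Suc i)) (D' i) (mat_mult (b (Suc i)) (S (Suc i)) N) =
      mat_mult (b i) (S i) (mat_mult (b (Suc i)) (E i) (mat_mult (b (Suc i)) (P (Suc i)) N))" for i N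
    by (simp add: D'_def QS[symmetric] mat_mult_assoc)
  (* A boundary N that the chain map fixes is the boundary of a vector in the image of the chain map. *)
  have surj: "\<exists>W'. A.entries_in C' W' \<and> mat_mult (c (Suc i)) (D' i) W' = mat_mult (b i) (S i) N"
    if N: "A.entries_in C' N" "mat_mult (b i) (P i) N = N"
      and W: "A.entries_in C W" "mat_mult (b (Suc i)) (D i) W = N" for i N W
  proof -
    have "N = retract_mat (mat_mult (b (Suc i)) (D i) W)" using N W by (simp add: retract_mat_id)
    also have "\<dots> = mat_mult (b (Suc i)) (E i) (retract_mat W)"
      unfolding E_def by (rule retract_mat_mult[OF D_C W(1)])
    finally have eq: "N = mat_mult (b (Suc i)) (E i) (retract_mat W)" .
    have "mat_mult (b (Suc i)) (E i) (mat_mult (b (Suc i)) (P (Suc i)) (retract_mat W)) =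
        mat_mult (b i) (P i) N"
      unfolding eq mat_mult_assoc[symmetric] chain'[symmetric] ..
    also have "\<dots> = N" by (rule N(2))
    finally have "mat_mult (c (Suc i)) (D' i) (mat_mult (b (Suc i)) (S (Suc i)) (retract_mat W)) =
        mat_mult (b i) (S i) N"
      by (simp add: D'_QS)
    moreover have "A.entries_in C' (mat_mult (b (Suc i)) (S (Suc i)) (retract_mat W))"
      using entries W(1) by (intro R.entries_in_mat_mult entries_in_retract_mat)
    ultimately show ?thesis by blast
  qed
  have "R.linear_resolution c D'"
    unfolding R.linear_resolution_def
  proof (intro conjI allI impI)
    show "c 0 = 1" by (rule c0)
    show "supported (c i) (c (Suc i)) (D' i)" for i
      unfolding D'_def by (rule supported_mat_mult[OF S(2) supported_mat_mult[OF E_supp Q(2)]])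
    show "A.entries_in (R.homogeneous 1) (D' i)" for i
    proof -
      have "A.entries_in (A.homogeneous (0 + (1 + 0))) (D' i)"
        unfolding D'_def by (intro homogeneous_mat_mult E_lin)
          (use Q(1) S(1) in \<open>simp_all add: constant_mat_def\<close>)
      moreover have "A.entries_in C' (D' i)"
        unfolding D'_def using entries by (intro R.entries_in_mat_mult)
      ultimately show ?thesis
        by (simp add: A.entries_in_def A.homogeneous_def R.homogeneous_def)
    qed
    show "mat_mult (c (Suc i)) (D' i) (D' (Suc i)) = (\<lambda>j l. 0)" for i
    proof -
      have "mat_mult (c (Suc i)) (D' i) (D' (Suc i)) = mat_mult (b i) (S i) (mat_mult (b (Suc i)) (E i)
          (mat_mult (b (Suc i)) (P (Suc i)) (mat_mult (b (Suc (Suc i))) (E (Suc i)) (Q (Suc (Suc i))))))"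
        unfolding D'_def[of "Suc i"] by (rule D'_QS)
      also have "mat_mult (b (Suc i)) (P (Suc i)) (mat_mult (b (Suc (Suc i))) (E (Suc i)) (Q (Suc (Suc i)))) =
          mat_mult (b (Suc (Suc i))) (E (Suc i)) (mat_mult (b (Suc (Suc i))) (P (Suc (Suc i))) (Q (Suc (Suc i))))"
        unfolding mat_mult_assoc[symmetric] chain' ..
      finally show ?thesis
        by (simp add: E_complex mat_mult_def[of "b (Suc (Suc i))" "\<lambda>j l. 0"] flip: mat_mult_assoc[of "b (Suc (Suc i))" "b (Suc i)"])
    qed
  next
    fix N assume N: "A.entries_in C' N \<and> (\<forall>k l. 1 \<le> k \<longrightarrow> N k l = 0) \<and> (\<forall>l. A.component 0 (N 0 l) = 0)"
    then obtain W where W: "A.entries_in C W" "mat_mult (b (Suc 0)) (D 0) W = N"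
      using aug[of N] entries_in_subset[OF _ retract_subset] by auto
    have one: "mat_mult (b 0) (mat_one 1) N = N" unfolding b0 using N by (intro mat_one_left) auto
    show "\<exists>W. A.entries_in C' W \<and> mat_mult (c 1) (D' 0) W = N"
      using surj[OF _ _ W] N one by (simp add: P_0 S0)
  next
    fix i N assume N: "A.entries_in C' N \<and> (\<forall>k l. c (Suc i) \<le> k \<longrightarrow> N k l = 0) \<and>
      mat_mult (c (Suc i)) (D' i) N = (\<lambda>j l. 0)"
    let ?QN = "mat_mult (c (Suc i)) (Q (Suc i)) N"
    have SQN: "mat_mult (b (Suc i)) (S (Suc i)) ?QN = N"
      unfolding mat_mult_assoc[symmetric] SQ using N by (intro mat_one_left) auto
    have PQN: "mat_mult (b (Suc i)) (P (Suc i)) ?QN = ?QN"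
      unfolding QS[symmetric] mat_mult_assoc[of "b (Suc i)"] SQN ..
    have QN_C': "A.entries_in C' ?QN" using N entries by (intro R.entries_in_mat_mult) auto
    have "\<exists>W. A.entries_in C W \<and> mat_mult (b (Suc (Suc i))) (D (Suc i)) W = ?QN"
    proof (rule exact)
      show "A.entries_in C ?QN" using QN_C' retract_subset by (rule entries_in_subset)
      show "?QN k l = 0" if "b (Suc i) \<le> k" for k l
        using Q(2)[of "Suc i"] that by (simp add: mat_mult_def supported_def)
      have "mat_mult (b (Suc i)) (D i) ?QN = mat_mult (b (Suc i)) (D i) (mat_mult (b (Suc i)) (P (Suc i)) ?QN)"
        unfolding PQN ..
      also have "\<dots> = mat_mult (b i) (P i) (mat_mult (b (Suc i)) (E i) ?QN)"
        by (simp only: chain mat_mult_assoc[symmetric])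
      also have "\<dots> = mat_mult (c i) (Q i) (mat_mult (c (Suc i)) (D' i) N)"
        by (simp add: D'_def QS[symmetric] mat_mult_assoc)
      also have "\<dots> = (\<lambda>j l. 0)" using N by simp
      finally show "mat_mult (b (Suc i)) (D i) ?QN = (\<lambda>j l. 0)" .
    qed
    then obtain W where "A.entries_in C W" "mat_mult (b (Suc (Suc i))) (D (Suc i)) W = ?QN" by blast
    from surj[OF QN_C' PQN this]
    show "\<exists>W. A.entries_in C' W \<and> mat_mult (c (Suc (Suc i))) (D' (Suc i)) W = N"
      unfolding SQN .
  qed
  then show ?thesis by (rule R.linear_resolution_imp_koszul)
qed

end

section \<open>Toric algebras\<close>

context graded_subalgebra
begin

lemma algebra_alg: "algebra (ring_of_type_algebra :: 'k ring) alg"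
proof -
  have single_times: "single 0 (a * b) = (single 0 a * single 0 b :: 'm \<Rightarrow>\<^sub>0 'k)" for a b
    by (simp add: mult_single)
  show ?thesis
    by (rule algebraI) (auto simp: ring_of_type_algebra_def[where 'a = 'k] single_add distrib_right distrib_left mult.assoc single_times
       cring_alg const_closed mult_closed intro: cring_from_type_algebra[unfolded ring_of_type_algebra_def])
qed

lemma submodule_homogeneous: "submodule (homog alg i) (ring_of_type_algebra :: 'k ring) alg"
proof (rule module.submoduleI[OF algebra.module[OF algebra_alg]])
  show "\<ominus>\<^bsub>alg\<^esub> f \<in> homog alg i" if "f \<in> homog alg i" for f
    using that a_inv_alg[of f] by (simp add: uminus_closed)
  show "f \<oplus>\<^bsub>alg\<^esub> g \<in> homog alg i" if "f \<in> homog alg i" "g \<in> homog alg i" for f g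
    using that homogeneous_closed(2)[of f i g] by (simp add: homogeneous_def)
  show "c \<odot>\<^bsub>alg\<^esub> f \<in> homog alg i" if "f \<in> homog alg i" for f c
    using that homogeneous_smult[of f i c] by (simp add: homogeneous_def)
qed (auto simp: zero_closed)

lemma component_eq_0_iff: "component i f = 0 \<longleftrightarrow> i \<notin> \<delta> ` keys f"
proof -
  have "component i f = 0 \<longleftrightarrow> keys (component i f) = {}" by simp
  then show ?thesis by (auto simp: component_def keys_restrict_keys simp del: keys_eq_empty)
qed

lemma unique_homogeneous_decomposition:
  assumes "f \<in> carrier alg"
  shows "\<exists>!g. (\<forall>i. g i \<in> homog alg i) \<and> finite {i. g i \<noteq> \<zero>\<^bsub>alg\<^esub>} \<and>
    f = finsum alg g {i. g i \<noteq> \<zero>\<^bsub>alg\<^esub>}"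
proof (rule ex1I[of _ "\<lambda>i. component i f"])
  have f: "f \<in> C" using assms by simp
  have comp: "component i f \<in> homog alg i" for i
    using component_in_homogeneous[OF f] by (simp add: homogeneous_def)
  have nonzero: "{i. component i f \<noteq> \<zero>\<^bsub>alg\<^esub>} = \<delta> ` keys f" by (auto simp: component_eq_0_iff)
  have "finsum alg (\<lambda>i. component i f) (\<delta> ` keys f) = f"
    using comp by (subst finsum_alg) (auto simp: sum_components)
  then show "(\<forall>i. component i f \<in> homog alg i) \<and> finite {i. component i f \<noteq> \<zero>\<^bsub>alg\<^esub>} \<and>
      f = finsum alg (\<lambda>i. component i f) {i. component i f \<noteq> \<zero>\<^bsub>alg\<^esub>}"
    unfolding nonzero using comp by simp
  fix g assume g: "(\<forall>i. g i \<in> homog alg i) \<and> finite {i. g i \<noteq> \<zero>\<^bsub>alg\<^esub>} \<and>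
    f = finsum alg g {i. g i \<noteq> \<zero>\<^bsub>alg\<^esub>}"
  then have g_hom: "g i \<in> homogeneous i" for i by (simp add: homogeneous_def)
  have "finsum alg g {i. g i \<noteq> \<zero>\<^bsub>alg\<^esub>} = sum g {i. g i \<noteq> \<zero>\<^bsub>alg\<^esub>}"
    using g_hom homogeneous_subset by (intro finsum_alg) blast
  then have "f = sum g {i. g i \<noteq> 0}" using g by simp
  then have "component i f = (\<Sum>j\<in>{i. g i \<noteq> 0}. if i = j then g j else 0)" for i
    by (simp add: component_sum component_homogeneous[OF g_hom])
  also have "\<dots> i = g i" for i using g by (simp add: sum.delta)
  finally show "g = (\<lambda>i. component i f)" by auto
qed

text \<open>Generation by \<open>G\<close> takes the form of an induction principle over sets closed under the operations,
which is what push-forwards of polynomials satisfy directly.\<close>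

lemma standard_graded_alg:
  assumes G: "finite G" "G \<subseteq> homogeneous 1"
    and generates: "\<And>Y. (\<And>c. single 0 c \<in> Y) \<Longrightarrow> G \<subseteq> Y \<Longrightarrow>
      (\<And>f g. f \<in> Y \<Longrightarrow> g \<in> Y \<Longrightarrow> f + g \<in> Y) \<Longrightarrow> (\<And>f g. f \<in> Y \<Longrightarrow> g \<in> Y \<Longrightarrow> f * g \<in> Y) \<Longrightarrow> C \<subseteq> Y"
  shows "standard_graded alg"
  unfolding standard_graded_def
proof (intro conjI allI ballI)
  interpret alg: cring alg by (rule cring_alg)
  have hom: "homog alg i = homogeneous i" for i by (simp add: homogeneous_def)
  show "f \<otimes>\<^bsub>alg\<^esub> g \<in> homog alg (i + j)" if "f \<in> homog alg i" "g \<in> homog alg j" for f g i j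
    using that homogeneous_closed(3) unfolding hom by simp
  show "\<one>\<^bsub>alg\<^esub> \<noteq> \<zero>\<^bsub>alg\<^esub>" by simp
  show "homog alg 0 = {c \<odot>\<^bsub>alg\<^esub> \<one>\<^bsub>alg\<^esub> |c. True}" unfolding hom homogeneous_0 by simp
  let ?Y = "generate_ring alg (homog alg 0 \<union> G)"
  have "C \<subseteq> ?Y"
  proof (rule generates)
    show "single 0 c \<in> ?Y" for c
      by (rule generate_ring.incl) (use homogeneous_0 hom in blast)
    show "f + g \<in> ?Y" "f * g \<in> ?Y" if "f \<in> ?Y" "g \<in> ?Y" for f g
      using generate_ring.eng_add[OF that] generate_ring.eng_mult[OF that] by simp_all
  qed (auto intro: generate_ring.incl)
  moreover have "?Y \<subseteq> carrier alg"
    using G(2) homogeneous_subset by (intro alg.generate_ring_incl) (auto simp: hom)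
  ultimately show "\<exists>G. finite G \<and> G \<subseteq> homog alg 1 \<and> carrier alg = generate_ring alg (homog alg 0 \<union> G)"
    using G unfolding hom by (intro exI[of _ G]) auto
qed (rule algebra_alg submodule_homogeneous unique_homogeneous_decomposition; assumption)+

end

definition toric_carrier :: "nat \<Rightarrow> (nat \<Rightarrow> nat) set \<Rightarrow> (nat, 'k::field) mpoly set" where
  "toric_carrier n S = push_keys (toric_monomial n) ` polys S"

abbreviation s_degree :: "nat monomial \<Rightarrow> nat" where "s_degree m \<equiv> lookup m 0"

lemma toric_algebra_eq: "toric_algebra n S = graded_alg s_degree (toric_carrier n S)"
  by (simp add: toric_algebra_def graded_alg_def toric_carrier_def poly_subst_toric_gen const_poly_def)

lemma s_degree_toric_monomial: "s_degree (toric_monomial n m) = (\<Sum>u\<in>keys m. lookup m u)"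
  by (simp add: lookup_subst_exponent lookup_toric_exponent)

lemma keys_toric_carrier: "f \<in> toric_carrier n S \<Longrightarrow> keys f \<subseteq> toric_monomial n ` monomials S"
  using keys_push_keys by (fastforce simp: toric_carrier_def polys_def)

lemma graded_subalgebra_toric: "graded_subalgebra s_degree (toric_carrier n S)"
proof
  show "s_degree (a + b) = s_degree a + s_degree b" for a b by (rule lookup_add)
  show "single 0 c \<in> toric_carrier n S" for c
    by (auto simp: toric_carrier_def polys_def intro!: image_eqI[of _ _ "single 0 c"] split: if_splits)
  show "f + g \<in> toric_carrier n S" "f * g \<in> toric_carrier n S"
    if "f \<in> toric_carrier n S" "g \<in> toric_carrier n S" for f g
    using that polys_closed(3,4)
    by (auto simp: toric_carrier_def subst_exponent_add simp flip: push_keys_add push_keys_times intro!: imageI)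
  show "restrict_keys {m. s_degree m = i} f \<in> toric_carrier n S" if "f \<in> toric_carrier n S" for f i
    using that by (auto simp: toric_carrier_def restrict_keys_push_keys polys_def keys_restrict_keys subset_iff intro!: imageI)
  show "\<exists>c. f = single 0 c" if f: "f \<in> toric_carrier n S" and deg_0: "\<And>m. m \<in> keys f \<Longrightarrow> s_degree m = 0" for f
  proof -
    have "keys f \<subseteq> {0}"
    proof
      fix e assume "e \<in> keys f"
      then obtain m where m: "e = toric_monomial n m" using keys_toric_carrier[OF f] by blast
      then have "(\<Sum>u\<in>keys m. lookup m u) = 0" using deg_0[OF \<open>e \<in> keys f\<close>] by (simp add: s_degree_toric_monomial)
      then have "lookup m u = 0" for u by (cases "u \<in> keys m") (auto simp: in_keys_iff)
      then have "m = 0" by (intro poly_mapping_eqI) simp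
      then show "e \<in> {0}" by (simp add: m)
    qed
    then show ?thesis using poly_mapping_eq_sum_single[of "{0}" f] by auto
  qed
qed

lemma toric_carrier_generated:
  fixes Y :: "(nat, 'k::field) mpoly set"
  assumes const: "\<And>c. single 0 c \<in> Y" and gens: "\<And>u. u \<in> S \<Longrightarrow> mono_poly (toric_exponent n u) \<in> Y"
    and add: "\<And>f g. f \<in> Y \<Longrightarrow> g \<in> Y \<Longrightarrow> f + g \<in> Y" and mult: "\<And>f g. f \<in> Y \<Longrightarrow> g \<in> Y \<Longrightarrow> f * g \<in> Y"
  shows "toric_carrier n S \<subseteq> Y"
proof -
  have zero_one: "0 \<in> Y" "1 \<in> Y" using const[of 0] const[of 1] by simp_all
  have power: "f ^ k \<in> Y" if "f \<in> Y" for f k using that zero_one mult by (induction k) auto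
  have prod: "(\<Prod>a\<in>A. f a) \<in> Y" if "\<And>a. a \<in> A \<Longrightarrow> f a \<in> Y" for f and A :: "(nat \<Rightarrow> nat) set"
    using that zero_one mult by (induction A rule: infinite_finite_induct) auto
  have sum: "(\<Sum>a\<in>A. f a) \<in> Y" if "\<And>a. a \<in> A \<Longrightarrow> f a \<in> Y" for f and A :: "(nat \<Rightarrow> nat) monomial set"
    using that zero_one add by (induction A rule: infinite_finite_induct) auto
  have mono: "mono_poly (toric_monomial n m) \<in> Y" if "m \<in> monomials S" for m
  proof -
    have "mono_poly (toric_monomial n m) = (\<Prod>u\<in>keys m. (mono_poly (toric_exponent n u) :: (nat, 'k) mpoly) ^ lookup m u)"
      by (simp add: subst_exponent_def mono_poly_prod mono_poly_power)
    then show ?thesis using that gens by (auto simp: monomials_def intro!: prod power)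
  qed
  have "single (toric_monomial n m) c \<in> Y" if "m \<in> monomials S" for m c
    using mult[OF const[of c] mono[OF that]] by (simp add: mono_poly_def mult_single)
  then show ?thesis
    by (auto simp: toric_carrier_def push_keys_def polys_def intro!: sum)
qed

lemma standard_graded_toric:
  assumes "finite S"
  shows "standard_graded (toric_algebra n S :: ('k::field, (nat, 'k) mpoly) graded_algebra)"
proof -
  interpret graded_subalgebra s_degree "toric_carrier n S :: (nat, 'k) mpoly set"
    by (rule graded_subalgebra_toric)
  let ?G = "(\<lambda>u. mono_poly (toric_exponent n u)) ` S"
  have "mono_poly (toric_exponent n u) \<in> homogeneous 1" if "u \<in> S" for u
  proof -
    have "push_keys (toric_monomial n) (single (single u 1) 1 :: (_, 'k) mpoly) = mono_poly (toric_exponent n u)"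
      by (simp add: subst_exponent_single mono_poly_def)
    moreover have "single (single u 1) 1 \<in> polys S" using that by (simp add: polys_def monomials_def)
    ultimately have "mono_poly (toric_exponent n u) \<in> (toric_carrier n S :: (nat, 'k) mpoly set)"
      unfolding toric_carrier_def by (metis imageI)
    then show ?thesis by (simp add: homogeneous_def mono_poly_def lookup_toric_exponent)
  qed
  then have G: "finite ?G" "?G \<subseteq> homogeneous 1" using assms by auto
  have "standard_graded alg"
  proof (rule standard_graded_alg[OF G])
    fix Y :: "(nat, 'k) mpoly set"
    assume Y: "\<And>c. single 0 c \<in> Y" "?G \<subseteq> Y" "\<And>f g. f \<in> Y \<Longrightarrow> g \<in> Y \<Longrightarrow> f + g \<in> Y"
      "\<And>f g. f \<in> Y \<Longrightarrow> g \<in> Y \<Longrightarrow> f * g \<in> Y"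
    show "toric_carrier n S \<subseteq> Y"
      by (rule toric_carrier_generated[OF Y(1) _ Y(3,4)]) (use Y(2) in auto)
  qed
  then show ?thesis by (simp add: toric_algebra_eq)
qed

context toric_face
begin

text \<open>On the monomials of \<open>K[S]\<close>, membership of a sum in \<open>W\<close> is equivalent to membership of both summands,
so removing the monomials outside \<open>W\<close> is multiplicative.\<close>

lemma graded_retract_face:
  "graded_retract s_degree (toric_carrier n S :: (nat, 'k::field) mpoly set) (toric_carrier n T) (restrict_keys W)"
proof (intro graded_retract.intro graded_subalgebra_toric graded_retract_axioms.intro)
  show "toric_carrier n T \<subseteq> (toric_carrier n S :: (nat, 'k) mpoly set)"
    unfolding toric_carrier_def using polys_mono[OF subset] by blast
  show closed: "restrict_keys W f \<in> toric_carrier n T" if "f \<in> toric_carrier n S" for f :: "(nat, 'k) mpoly"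
    using that restrict_face restrict_monomials_in_polys by (auto simp: toric_carrier_def)
  show "restrict_keys W f = f" if "f \<in> toric_carrier n T" for f :: "(nat, 'k) mpoly"
    using that restrict_face restrict_monomials_id polys_mono[OF subset] by (fastforce simp: toric_carrier_def)
  show "restrict_keys W (f + g) = restrict_keys W f + restrict_keys W g" for f g :: "(nat, 'k) mpoly"
    by (rule restrict_keys_add)
  show "restrict_keys W (f * g) = restrict_keys W f * restrict_keys W g"
    if "f \<in> toric_carrier n S" "g \<in> toric_carrier n S" for f g :: "(nat, 'k) mpoly"
  proof (rule restrict_keys_times)
    fix a b assume "a \<in> keys f" "b \<in> keys g"
    then have "a \<in> toric_monomial n ` monomials S" "b \<in> toric_monomial n ` monomials S"
      using that keys_toric_carrier by blast+
    then obtain k l where kl: "k \<in> monomials S" "l \<in> monomials S" and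
      ab: "a = toric_monomial n k" "b = toric_monomial n l"
      by blast
    show "a + b \<in> W \<longleftrightarrow> a \<in> W \<and> b \<in> W"
      using face[of "k + l"] face[of k] face[of l] kl
      by (simp add: ab add_in_monomials_iff flip: subst_exponent_add)
  qed
  show "restrict_keys W f \<in> graded_subalgebra.homogeneous s_degree (toric_carrier n T) i"
    if "f \<in> graded_subalgebra.homogeneous s_degree (toric_carrier n S) i" for f :: "(nat, 'k) mpoly" and i
    using that closed[of f] keys_restrict_keys[of W f]
    by (auto simp: graded_subalgebra.homogeneous_def[OF graded_subalgebra_toric])
qed

lemma koszul_face:
  assumes "koszul (toric_algebra n S :: ('k::field, (nat, 'k) mpoly) graded_algebra)"
  shows "koszul (toric_algebra n T :: ('k, (nat, 'k) mpoly) graded_algebra)"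
  using graded_retract.koszul_retract[OF graded_retract_face] assms unfolding toric_algebra_eq .

end

section \<open>The bases of a discrete polymatroid form a face\<close>

lemma modulus_Suc: "modulus (Suc n) u = modulus n u + u (Suc n)"
  by (simp add: modulus_def)

lemma modulus_mono: "u \<le> v \<Longrightarrow> modulus n u \<le> modulus n v"
  by (simp add: modulus_def le_fun_def sum_mono)

lemma modulus_strict_mono:
  assumes "u < v" "v \<in> nn_vectors n"
  shows "modulus n u < modulus n v"
proof -
  have le: "\<And>i. u i \<le> v i" using le_funD[OF less_imp_le[OF assms(1)]] .
  have "u \<noteq> v" using assms(1) by simp
  with le obtain i where "u i < v i" by (metis ext le_neq_implies_less)
  moreover from this have "i \<in> {1..n}" using assms(2) by (auto simp: nn_vectors_def)
  ultimately show ?thesis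
    unfolding modulus_def using le by (intro sum_strict_mono_ex1) auto
qed

lemma modulus_upd_Suc:
  assumes "i \<in> {1..n}"
  shows "modulus n (u(i := Suc (u i))) = Suc (modulus n u)"
proof -
  have "modulus n w = w i + (\<Sum>j\<in>{1..n} - {i}. w j)" for w
    unfolding modulus_def using assms by (intro sum.remove) auto
  then show ?thesis by simp
qed

lemma modulus_upd_outside: "i \<notin> {1..n} \<Longrightarrow> modulus n (u(i := a)) = modulus n u"
  unfolding modulus_def by (intro sum.cong) auto

lemma polymatroid_exchange:
  assumes "discrete_polymatroid n P" "u \<in> P" "v \<in> P" "modulus n u < modulus n v"
  shows "\<exists>w\<in>P. u < w \<and> w \<le> sup u v"
  using assms by (simp add: discrete_polymatroid_def)

lemma polymatroid_lower:
  assumes "discrete_polymatroid n P" "u \<in> P" "v \<in> nn_vectors n" "v \<le> u"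
  shows "v \<in> P"
  using assms by (auto simp: discrete_polymatroid_def)

text \<open>By the exchange property, a vector whose modulus is not maximal can be enlarged.\<close>

lemma bases_eq_maximal_modulus:
  assumes P: "discrete_polymatroid n P" and d: "u \<in> P" "modulus n u = d" "\<And>v. v \<in> P \<Longrightarrow> modulus n v \<le> d"
  shows "bases P = {v \<in> P. modulus n v = d}"
proof (intro equalityI subsetI)
  fix v assume "v \<in> bases P"
  then have v: "v \<in> P" "\<not> (\<exists>w\<in>P. v < w)" by (auto simp: bases_def)
  have "\<not> modulus n u > modulus n v"
    using polymatroid_exchange[OF P v(1) d(1)] v(2) by blast
  then show "v \<in> {v \<in> P. modulus n v = d}" using v d by (simp add: order_antisym not_less)
next
  fix v assume v: "v \<in> {v \<in> P. modulus n v = d}"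
  have "\<not> v < w" if "w \<in> P" for w
  proof
    assume "v < w"
    have "w \<in> nn_vectors n" using P that by (auto simp: discrete_polymatroid_def)
    from modulus_strict_mono[OF \<open>v < w\<close> this] d(3)[OF that] v show False by simp
  qed
  then show "v \<in> bases P" using v by (auto simp: bases_def)
qed

lemma polymatroid_rank:
  assumes "discrete_polymatroid n P"
  shows "\<exists>d. bases P = {v \<in> P. modulus n v = d} \<and> (\<forall>v\<in>P. modulus n v \<le> d)"
proof -
  have fin: "finite (modulus n ` P)" "modulus n ` P \<noteq> {}" using assms by (auto simp: discrete_polymatroid_def)
  obtain u where u: "u \<in> P" "modulus n u = Max (modulus n ` P)" using Max_in[OF fin] by auto
  have le: "modulus n v \<le> Max (modulus n ` P)" if "v \<in> P" for v using that fin by simp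
  show ?thesis using bases_eq_maximal_modulus[OF assms u le] le by (intro exI conjI ballI)
qed

lemma sum_lookup_toric_monomial:
  "(\<Sum>i=1..n. lookup (toric_monomial n m) i) = (\<Sum>u\<in>keys m. lookup m u * modulus n u)"
proof -
  have "(\<Sum>i=1..n. lookup (toric_monomial n m) i) = (\<Sum>i=1..n. \<Sum>u\<in>keys m. lookup m u * u i)"
    by (intro sum.cong) (auto simp: lookup_subst_exponent lookup_toric_exponent)
  also have "\<dots> = (\<Sum>u\<in>keys m. \<Sum>i=1..n. lookup m u * u i)" by (rule sum.swap)
  finally show ?thesis by (simp add: modulus_def sum_distrib_left)
qed

text \<open>The weight, \<open>d\<close> times the degree in \<open>s\<close> minus the degree in the \<open>t\<^sub>i\<close>, is additive and nonnegative on
the monomials of \<open>K[S]\<close>. It vanishes on a product of generators if and only if it vanishes on each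
of them.\<close>

lemma toric_face_maximal_modulus:
  assumes "\<And>u. u \<in> S \<Longrightarrow> modulus n u \<le> d"
  shows "toric_face n S {u \<in> S. modulus n u = d} {e. (\<Sum>i=1..n. lookup e i) = d * lookup e 0}"
proof
  fix m assume m: "m \<in> monomials S"
  have le: "lookup m u * modulus n u \<le> lookup m u * d" if "u \<in> keys m" for u
    using m that assms by (auto simp: monomials_def)
  have "(\<Sum>u\<in>keys m. lookup m u * modulus n u) = (\<Sum>u\<in>keys m. lookup m u * d) \<longleftrightarrow>
      (\<forall>u\<in>keys m. lookup m u * modulus n u = lookup m u * d)"
    using le sum_mono_inv[of "\<lambda>u. lookup m u * modulus n u" "keys m" "\<lambda>u. lookup m u * d"]
    by (auto intro: sum.cong)
  also have "\<dots> \<longleftrightarrow> m \<in> monomials {u \<in> S. modulus n u = d}"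
    using m by (auto simp: monomials_def in_keys_iff)
  finally show "toric_monomial n m \<in> {e. (\<Sum>i=1..n. lookup e i) = d * lookup e 0} \<longleftrightarrow>
      m \<in> monomials {u \<in> S. modulus n u = d}"
    unfolding mem_Collect_eq sum_lookup_toric_monomial s_degree_toric_monomial sum_distrib_left
    by (simp add: mult.commute)
qed auto

section \<open>Homogenization of a discrete polymatroid\<close>

text \<open>A new coordinate is added, bounded by what is missing to the modulus \<open>d\<close>.\<close>

definition homogenization :: "nat \<Rightarrow> nat \<Rightarrow> (nat \<Rightarrow> nat) set \<Rightarrow> (nat \<Rightarrow> nat) set" where
  "homogenization n d P = {v \<in> nn_vectors (Suc n). v(Suc n := 0) \<in> P \<and> modulus (Suc n) v \<le> d}"

text \<open>For the exchange property one coordinate \<open>i\<close> of \<open>u\<close> with \<open>u i < v i\<close> is increased by 1. If the new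
coordinate does not qualify, then the old parts of \<open>u\<close> and \<open>v\<close> differ in modulus, and the exchange
property of \<open>P\<close> provides \<open>i\<close>. The modulus stays at most \<open>d\<close>, as \<open>v\<close> has larger modulus than \<open>u\<close>.\<close>

lemma discrete_polymatroid_homogenization:
  assumes P: "discrete_polymatroid n P" and d: "u0 \<in> P" "modulus n u0 \<le> d"
  shows "discrete_polymatroid (Suc n) (homogenization n d P)"
proof -
  let ?H = "homogenization n d P"
  have P_nn: "P \<subseteq> nn_vectors n" and P_fin: "finite P"
    using P by (simp_all add: discrete_polymatroid_def)
  note down = polymatroid_lower[OF P] and exch = polymatroid_exchange[OF P]
  have P_last: "u (Suc n) = 0" if "u \<in> P" for u using that P_nn by (auto simp: nn_vectors_def)
  have "u0 \<in> ?H"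
    using d P_nn P_last[OF d(1)] by (auto simp: homogenization_def modulus_Suc nn_vectors_def fun_upd_idem)
  moreover have "finite ?H"
  proof (rule finite_subset)
    show "?H \<subseteq> (\<lambda>(u, a). u(Suc n := a)) ` (P \<times> {..d})"
    proof
      fix v assume "v \<in> ?H"
      then have "(v(Suc n := 0), v (Suc n)) \<in> P \<times> {..d}" by (auto simp: homogenization_def modulus_Suc)
      then show "v \<in> (\<lambda>(u, a). u(Suc n := a)) ` (P \<times> {..d})" by (rule rev_image_eqI) simp
    qed
  qed (use P_fin in simp)
  moreover have "?H \<subseteq> nn_vectors (Suc n)" by (auto simp: homogenization_def)
  moreover have "v \<in> ?H" if u: "u \<in> ?H" and v: "v \<in> nn_vectors (Suc n)" "v \<le> u" for u v
  proof -
    have "v(Suc n := 0) \<le> u(Suc n := 0)" using v(2) by (simp add: le_fun_def)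
    moreover have "v(Suc n := 0) \<in> nn_vectors n" using v(1) by (auto simp: nn_vectors_def)
    moreover have "modulus (Suc n) v \<le> modulus (Suc n) u" by (rule modulus_mono[OF v(2)])
    ultimately show ?thesis using u v(1) down by (auto simp: homogenization_def)
  qed
  moreover have "\<exists>w\<in>?H. u < w \<and> w \<le> sup u v"
    if uv: "u \<in> ?H" "v \<in> ?H" and less: "modulus (Suc n) u < modulus (Suc n) v" for u v
  proof -
    have "\<exists>i\<in>{1..Suc n}. u i < v i \<and> u(i := Suc (u i)) \<in> ?H"
    proof (cases "u (Suc n) < v (Suc n)")
      case True
      have "modulus (Suc n) (u(Suc n := Suc (u (Suc n)))) \<le> d"
        using uv(2) less by (subst modulus_upd_Suc) (auto simp: homogenization_def)
      then have "u(Suc n := Suc (u (Suc n))) \<in> ?H"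
        using uv(1) by (auto simp: homogenization_def nn_vectors_def)
      then show ?thesis using True by (intro bexI[of _ "Suc n"]) auto
    next
      case False
      have "modulus n (u(Suc n := 0)) < modulus n (v(Suc n := 0))"
        using less False by (simp add: modulus_Suc modulus_upd_outside)
      then obtain w where w: "w \<in> P" "u(Suc n := 0) < w" "w \<le> sup (u(Suc n := 0)) (v(Suc n := 0))"
        using exch[of "u(Suc n := 0)" "v(Suc n := 0)"] uv by (auto simp: homogenization_def)
      then obtain i where i: "(u(Suc n := 0)) i < w i"
        by (metis le_fun_def less_le_not_le not_le)
      have "w \<in> nn_vectors n" using w(1) P_nn by blast
      have i_le: "i \<in> {1..n}"
      proof (rule ccontr)
        assume "i \<notin> {1..n}"
        then have "w i = 0" using \<open>w \<in> nn_vectors n\<close> by (simp add: nn_vectors_def)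
        then show False using i by simp
      qed
      have "w i \<le> sup (u i) (v i)" using le_funD[OF w(3), of i] i_le by auto
      then have "u i < v i" using i i_le by (auto simp: sup_nat_def)
      have "u j \<le> w j" if "j \<noteq> Suc n" for j
        using le_funD[OF less_imp_le[OF w(2)], of j] that by simp
      then have "u(i := Suc (u i), Suc n := 0) \<le> w"
        using i i_le by (auto simp: le_fun_def)
      moreover have "u(i := Suc (u i), Suc n := 0) \<in> nn_vectors n"
        using uv(1) i_le by (auto simp: homogenization_def nn_vectors_def)
      ultimately have "u(i := Suc (u i), Suc n := 0) \<in> P" using down w(1) by blast
      moreover have "modulus (Suc n) (u(i := Suc (u i))) \<le> d"
        using uv(2) less i_le by (subst modulus_upd_Suc) (auto simp: homogenization_def)
      moreover have "u(i := Suc (u i)) \<in> nn_vectors (Suc n)"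
        using uv(1) i_le by (auto simp: homogenization_def nn_vectors_def)
      ultimately have "u(i := Suc (u i)) \<in> ?H" by (simp add: homogenization_def)
      then show ?thesis using \<open>u i < v i\<close> i_le by (intro bexI[of _ i]) auto
    qed
    then obtain i where i: "u i < v i" "u(i := Suc (u i)) \<in> ?H" by blast
    have "u \<le> u(i := Suc (u i))" by (simp add: le_fun_def)
    moreover have "u \<noteq> u(i := Suc (u i))" by (metis fun_upd_same n_not_Suc_n)
    ultimately have "u < u(i := Suc (u i))" by (simp add: less_le)
    moreover have "u(i := Suc (u i)) \<le> sup u v" using i(1) by (auto simp: le_fun_def sup_nat_def)
    ultimately show ?thesis using i(2) by blast
  qed
  ultimately show ?thesis unfolding discrete_polymatroid_def by blast
qed

text \<open>A base has the maximal modulus \<open>d\<close>, which determines its last coordinate.\<close>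

lemma bases_homogenization:
  assumes P: "discrete_polymatroid n P" and d: "\<And>u. u \<in> P \<Longrightarrow> modulus n u \<le> d"
  shows "bases (homogenization n d P) = (\<lambda>u. u(Suc n := d - modulus n u)) ` P"
proof -
  let ?H = "homogenization n d P"
  have P_nn: "P \<subseteq> nn_vectors n" using P by (simp add: discrete_polymatroid_def)
  have lift: "u(Suc n := d - modulus n u) \<in> ?H \<and> modulus (Suc n) (u(Suc n := d - modulus n u)) = d"
    if "u \<in> P" for u
  proof -
    have "modulus (Suc n) (u(Suc n := d - modulus n u)) = d"
      using d[OF that] by (simp add: modulus_Suc modulus_upd_outside)
    moreover have "u(Suc n := 0) = u" using that P_nn by (auto simp: nn_vectors_def fun_upd_idem)
    ultimately show ?thesis using that P_nn by (auto simp: homogenization_def nn_vectors_def)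
  qed
  obtain u0 where u0: "u0 \<in> P" using P by (auto simp: discrete_polymatroid_def)
  have "bases ?H = {v \<in> ?H. modulus (Suc n) v = d}"
    using lift[OF u0] d[OF u0] u0 P
    by (intro bases_eq_maximal_modulus[of "Suc n" _ "u0(Suc n := d - modulus n u0)"]
        discrete_polymatroid_homogenization) (auto simp: homogenization_def)
  also have "\<dots> = (\<lambda>u. u(Suc n := d - modulus n u)) ` P"
  proof
    show "{v \<in> ?H. modulus (Suc n) v = d} \<subseteq> (\<lambda>u. u(Suc n := d - modulus n u)) ` P"
    proof
      fix v assume v: "v \<in> {v \<in> ?H. modulus (Suc n) v = d}"
      then have "v = (v(Suc n := 0))(Suc n := d - modulus n (v(Suc n := 0)))"
        by (auto simp: modulus_Suc modulus_upd_outside)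
      moreover have "v(Suc n := 0) \<in> P" using v by (simp add: homogenization_def)
      ultimately show "v \<in> (\<lambda>u. u(Suc n := d - modulus n u)) ` P" by (rule image_eqI)
    qed
  qed (use lift in auto)
  finally show ?thesis .
qed

lemma push_keys_polys:
  assumes "p \<in> polys S" "f ` S \<subseteq> T"
  shows "push_keys (push_keys f) p \<in> polys T"
proof -
  have "push_keys f m \<in> monomials T" if "m \<in> monomials S" for m
    using that keys_push_keys[of f m] assms(2) by (force simp: monomials_def)
  then show ?thesis
    using keys_push_keys[of "push_keys f" p] assms(1) by (force simp: polys_def)
qed

definition forget_variable :: "nat \<Rightarrow> nat monomial \<Rightarrow> nat monomial" where
  "forget_variable i = restrict_keys (- {i})"

lemma forget_variable_add: "forget_variable i (a + b) = forget_variable i a + forget_variable i b"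
  by (simp add: forget_variable_def restrict_keys_add)

lemma forget_variable_0 [simp]: "forget_variable i 0 = 0"
  by (simp add: forget_variable_def)

lemma lookup_forget_variable: "lookup (forget_variable i e) j = (if j = i then 0 else lookup e j)"
  by (simp add: forget_variable_def lookup_restrict_keys)

lemma forget_variable_toric_monomial:
  "forget_variable (Suc n) (toric_monomial (Suc n) m) = toric_monomial n (push_keys (\<lambda>v. v(Suc n := 0)) m)"
  unfolding subst_exponent_push_keys
  by (rule poly_mapping_eqI) (auto simp: lookup_forget_variable lookup_subst_exponent lookup_toric_exponent intro!: sum.cong)

text \<open>The isomorphism sets the last variable to 1. It is injective, because every monomial \<open>e\<close> of the
homogenized algebra has degree \<open>d * lookup e 0\<close> in the variables \<open>t\<^sub>i\<close>, which recovers the exponent of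
the last variable from the others.\<close>

lemma graded_iso_homogenization:
  assumes P: "P \<subseteq> nn_vectors n" and d: "\<And>u. u \<in> P \<Longrightarrow> modulus n u \<le> d"
  defines "B \<equiv> (\<lambda>u. u(Suc n := d - modulus n u)) ` P"
  shows "push_keys (forget_variable (Suc n)) \<in>
    graded_iso (toric_algebra (Suc n) B :: ('k::field, (nat, 'k) mpoly) graded_algebra) (toric_algebra n P)"
proof -
  let ?\<rho> = "forget_variable (Suc n)"
  let ?A = "toric_carrier (Suc n) B :: (nat, 'k) mpoly set"
  let ?A' = "toric_carrier n P :: (nat, 'k) mpoly set"
  have drop_P: "u(Suc n := 0) = u" if "u \<in> P" for u
    using that P by (auto simp: nn_vectors_def fun_upd_idem)
  have drop_B: "v(Suc n := 0) \<in> P" and mod_B: "modulus (Suc n) v = d" if "v \<in> B" for v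
  proof -
    from that obtain u where u: "u \<in> P" "v = u(Suc n := d - modulus n u)" by (auto simp: B_def)
    show "v(Suc n := 0) \<in> P" using u drop_P[of u] by simp
    show "modulus (Suc n) v = d" using u d[of u] by (simp add: modulus_Suc modulus_upd_outside)
  qed
  have inj: "inj_on ?\<rho> (toric_monomial (Suc n) ` monomials B)"
  proof (rule inj_onI)
    have total: "(\<Sum>i=1..n. lookup e i) + lookup e (Suc n) = lookup e 0 * d"
      if "e \<in> toric_monomial (Suc n) ` monomials B" for e
    proof -
      from that obtain m where m: "e = toric_monomial (Suc n) m" "m \<in> monomials B" by blast
      have "(\<Sum>u\<in>keys m. lookup m u * modulus (Suc n) u) = (\<Sum>u\<in>keys m. lookup m u * d)"
        using m(2) mod_B by (intro sum.cong) (auto simp: monomials_def)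
      then show ?thesis
        using sum_lookup_toric_monomial[of "Suc n" m] s_degree_toric_monomial[of "Suc n" m]
        by (simp add: m(1) sum_distrib_right)
    qed
    fix e f assume e: "e \<in> toric_monomial (Suc n) ` monomials B" and f: "f \<in> toric_monomial (Suc n) ` monomials B"
      and eq: "?\<rho> e = ?\<rho> f"
    have same: "lookup e i = lookup f i" if "i \<noteq> Suc n" for i
      using arg_cong[OF eq, of "\<lambda>g. lookup g i"] that by (simp add: lookup_forget_variable)
    then have "(\<Sum>i=1..n. lookup e i) = (\<Sum>i=1..n. lookup f i)" by (intro sum.cong) auto
    then have "lookup e (Suc n) = lookup f (Suc n)" using total[OF e] total[OF f] same[of 0] by simp
    then show "e = f" using same by (metis poly_mapping_eqI)
  qed
  have closed: "push_keys ?\<rho> f \<in> ?A'" if f: "f \<in> ?A" for f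
  proof -
    obtain p where p: "f = push_keys (toric_monomial (Suc n)) p" "p \<in> polys B"
      using f by (auto simp: toric_carrier_def)
    have "push_keys ?\<rho> f = push_keys (toric_monomial n) (push_keys (push_keys (\<lambda>v. v(Suc n := 0))) p)"
      by (simp add: p(1) push_keys_push_keys forget_variable_toric_monomial)
    moreover have "push_keys (push_keys (\<lambda>v. v(Suc n := 0))) p \<in> polys P"
      using p(2) drop_B by (intro push_keys_polys) auto
    ultimately show ?thesis by (auto simp: toric_carrier_def)
  qed
  have surj: "\<exists>f\<in>?A. push_keys ?\<rho> f = g" if g: "g \<in> ?A'" for g
  proof -
    obtain p where p: "g = push_keys (toric_monomial n) p" "p \<in> polys P"
      using g by (auto simp: toric_carrier_def)
    let ?q = "push_keys (push_keys (\<lambda>u. u(Suc n := d - modulus n u))) p"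
    have "?q \<in> polys B"
      using p(2) by (intro push_keys_polys) (auto simp: B_def)
    moreover have "push_keys ?\<rho> (push_keys (toric_monomial (Suc n)) ?q) = g"
    proof -
      have "push_keys (\<lambda>u. u(Suc n := 0)) m = m" if "m \<in> keys p" for m
        using that p(2) drop_P by (intro push_keys_ident) (auto simp: polys_def monomials_def)
      then show ?thesis
        unfolding p(1) by (auto simp: push_keys_push_keys forget_variable_toric_monomial intro: push_keys_cong)
    qed
    ultimately show ?thesis unfolding toric_carrier_def by blast
  qed
  have s_degree_\<rho>: "s_degree (?\<rho> e) = s_degree e" for e by (simp add: lookup_forget_variable)
  have "push_keys ?\<rho> 1 = (1 :: (nat, 'k) mpoly)"
    using push_keys_single[of ?\<rho> 0 "1::'k"] by simp
  then have "push_keys ?\<rho> \<in> ring_hom (graded_alg s_degree ?A) (graded_alg s_degree ?A')"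
    by (intro ring_hom_memI)
       (auto simp: closed push_keys_add push_keys_times forget_variable_add)
  moreover have "bij_betw (push_keys ?\<rho>) ?A ?A'"
  proof (rule bij_betw_imageI)
    show "inj_on (push_keys ?\<rho>) ?A"
      by (rule inj_onI) (rule push_keys_inj[OF inj keys_toric_carrier keys_toric_carrier])
    show "push_keys ?\<rho> ` ?A = ?A'" using closed surj by blast
  qed
  moreover have "push_keys ?\<rho> (single 0 c * f) = single 0 c * push_keys ?\<rho> f" for c :: 'k and f
    by (simp add: push_keys_times forget_variable_add)
  moreover have "push_keys ?\<rho> ` {f \<in> ?A. \<forall>m\<in>keys f. s_degree m = i} =
      {g \<in> ?A'. \<forall>m\<in>keys g. s_degree m = i}" for i
  proof (intro equalityI subsetI)
    fix g assume "g \<in> push_keys ?\<rho> ` {f \<in> ?A. \<forall>m\<in>keys f. s_degree m = i}"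
    then show "g \<in> {g \<in> ?A'. \<forall>m\<in>keys g. s_degree m = i}"
      using closed keys_push_keys[of ?\<rho>] s_degree_\<rho> by fastforce
  next
    fix g assume g: "g \<in> {g \<in> ?A'. \<forall>m\<in>keys g. s_degree m = i}"
    then obtain f where f: "f \<in> ?A" "push_keys ?\<rho> f = g" using surj by blast
    let ?f = "restrict_keys {m. s_degree m = i} f"
    have "push_keys ?\<rho> ?f = restrict_keys {m. s_degree m = i} (push_keys ?\<rho> f)"
      unfolding restrict_keys_push_keys by (simp add: vimage_def s_degree_\<rho>)
    also have "\<dots> = g" unfolding f(2) using g by (intro restrict_keys_id) auto
    finally have "push_keys ?\<rho> ?f = g" .
    moreover have "?f \<in> ?A"
      using graded_subalgebra.component_closed[OF graded_subalgebra_toric f(1)] .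
    ultimately show "g \<in> push_keys ?\<rho> ` {f \<in> ?A. \<forall>m\<in>keys f. s_degree m = i}"
      by (auto simp: keys_restrict_keys intro!: image_eqI[of _ _ ?f])
  qed
  ultimately show ?thesis by (simp add: graded_iso_def ring_iso_def toric_algebra_eq)
qed

section \<open>From a discrete polymatroid to its bases and back\<close>

theorem theorem6p3:
  shows "(\<forall>n P. discrete_polymatroid n P \<longrightarrow>
       (quadratically_generated P (defining_ideal n P :: (nat \<Rightarrow> nat, 'k::field) mpoly set) \<longrightarrow>
        quadratically_generated (bases P) (defining_ideal n (bases P) :: (nat \<Rightarrow> nat, 'k) mpoly set)) \<and>
       (has_quadratic_groebner_basis P (defining_ideal n P :: (nat \<Rightarrow> nat, 'k) mpoly set) \<longrightarrow>
        has_quadratic_groebner_basis (bases P) (defining_ideal n (bases P) :: (nat \<Rightarrow> nat, 'k) mpoly set)) \<and>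
       (koszul (toric_algebra n P :: ('k, (nat, 'k) mpoly) graded_algebra) \<longrightarrow>
        koszul (toric_algebra n (bases P) :: ('k, (nat, 'k) mpoly) graded_algebra))) \<and>
     (\<forall>E :: ('k, (nat, 'k) mpoly) graded_algebra \<Rightarrow> bool.
       (\<forall>A B. standard_graded A \<and> standard_graded B \<and> graded_iso A B \<noteq> {} \<and> E A \<longrightarrow> E B) \<longrightarrow>
       (\<forall>n P. discrete_polymatroid n P \<longrightarrow> E (toric_algebra n (bases P))) \<longrightarrow>
       (\<forall>n P. discrete_polymatroid n P \<longrightarrow> E (toric_algebra n P)))"
proof (intro conjI allI impI)
  fix n P assume P: "discrete_polymatroid n P"
  obtain d where d: "bases P = {v \<in> P. modulus n v = d}" "\<forall>v\<in>P. modulus n v \<le> d"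
    using polymatroid_rank[OF P] by (elim exE conjE)
  have face: "toric_face n P (bases P) {e. (\<Sum>i=1..n. lookup e i) = d * lookup e 0}"
    unfolding d(1) by (rule toric_face_maximal_modulus[OF d(2)[rule_format]])
  show "quadratically_generated (bases P) (defining_ideal n (bases P) :: (nat \<Rightarrow> nat, 'k) mpoly set)"
    if "quadratically_generated P (defining_ideal n P :: (nat \<Rightarrow> nat, 'k) mpoly set)"
    using toric_face.quadratically_generated_face[OF face that] .
  show "has_quadratic_groebner_basis (bases P) (defining_ideal n (bases P) :: (nat \<Rightarrow> nat, 'k) mpoly set)"
    if "has_quadratic_groebner_basis P (defining_ideal n P :: (nat \<Rightarrow> nat, 'k) mpoly set)"
    using toric_face.quadratic_groebner_basis_face[OF face that] .
  show "koszul (toric_algebra n (bases P) :: ('k, (nat, 'k) mpoly) graded_algebra)"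
    if "koszul (toric_algebra n P :: ('k, (nat, 'k) mpoly) graded_algebra)"
    using toric_face.koszul_face[OF face that] .
next
  fix E :: "('k, (nat, 'k) mpoly) graded_algebra \<Rightarrow> bool" and n P
  assume invariant: "\<forall>A B. standard_graded A \<and> standard_graded B \<and> graded_iso A B \<noteq> {} \<and> E A \<longrightarrow> E B"
    and bases: "\<forall>n P. discrete_polymatroid n P \<longrightarrow> E (toric_algebra n (bases P))"
    and P: "discrete_polymatroid n P"
  obtain d where "\<forall>v\<in>P. modulus n v \<le> d"
    using polymatroid_rank[OF P] by (elim exE conjE)
  then have d: "\<And>v. v \<in> P \<Longrightarrow> modulus n v \<le> d" by simp
  obtain u where u: "u \<in> P" using P by (auto simp: discrete_polymatroid_def)
  let ?H = "homogenization n d P"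
  have H: "discrete_polymatroid (Suc n) ?H"
    by (rule discrete_polymatroid_homogenization[OF P u d[OF u]])
  have bases_H: "bases ?H = (\<lambda>u. u(Suc n := d - modulus n u)) ` P"
    by (rule bases_homogenization[OF P d])
  have P_props: "P \<subseteq> nn_vectors n" "finite P" using P by (simp_all add: discrete_polymatroid_def)
  have "push_keys (forget_variable (Suc n)) \<in>
      graded_iso (toric_algebra (Suc n) (bases ?H) :: ('k, (nat, 'k) mpoly) graded_algebra) (toric_algebra n P)"
    unfolding bases_H by (rule graded_iso_homogenization[OF P_props(1) d])
  then have "graded_iso (toric_algebra (Suc n) (bases ?H) :: ('k, (nat, 'k) mpoly) graded_algebra) (toric_algebra n P) \<noteq> {}"
    by (metis empty_iff)
  moreover have "finite (bases ?H)" using P_props(2) by (simp add: bases_H)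
  moreover have "E (toric_algebra (Suc n) (bases ?H))" using bases H by simp
  ultimately show "E (toric_algebra n P)"
    using invariant standard_graded_toric P_props(2) by metis
qed

end
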